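(* Let $G=(V,E)$ be a finite undirected unweighted graph and let $e=\{u,v\}\in E$ with $\deg_G(u)\le \deg_G(v)$. Suppose there is an algorithm $\mathfrak{A}$ that, for every instance $H=(A,B,w)$ of the problem MPMCT (defined in the context), outputs an $(\alpha,\varepsilon)$-estimate of the MPMCT value of $H$ in $O(|A|^{2+\mu})$ time, for some fixed $\mu\ge 0$. Then there exists an algorithm $\mathfrak{A}_<$ that, given the edge-weighted complete bipartite graph $G_{u,v}$, runs in $O(\deg_G(v)^{2+\mu})$ time and outputs an estimate of the optimal value $\mathrm{EMD}_{G_{u,v}}(\mathbb{P}_u^G,\mathbb{P}_v^G)$ of the linear program (LP) with the following guarantees: (i) it is an $(\alpha,\varepsilon)$-estimate if $\deg_G(v)+1$ is an integral multiple of $\deg_G(u)+1$; (ii) for any $\delta>0$, it is an $(\alpha,\varepsilon+\delta)$-estimate provided at least one of the following holds: (a) $\deg_G(u)\le (\delta/3)\deg_G(v)$, or (b) $\deg_G(u)\ge (1-\delta/3)\deg_G(v)$.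
   Context: For a graph $G$, $\mathsf{Nbr}_G(x)$ is the set of neighbors of $x$, $\deg_G(x)=|\mathsf{Nbr}_G(x)|$, and $\mathrm{dist}_G(x,y)$ is the shortest-path distance. For an edge $\{u,v\}$, $G_{u,v}=(L^G_{u,v},R^G_{u,v},w^G_{u,v})$ is the edge-weighted complete bipartite graph with left side $L^G_{u,v}=\{u\}\cup\mathsf{Nbr}_G(u)$, right side $R^G_{u,v}=\{v\}\cup\mathsf{Nbr}_G(v)$ (taken as disjoint copies), and weights $w^G_{u,v}(x,y)=\mathrm{dist}_G(x,y)$ (so weights lie in $\{0,1,2,3\}$). $\mathbb{P}_u^G$ is the uniform distribution on $L^G_{u,v}$ (each mass $1/(1+\deg_G(u))$) and $\mathbb{P}_v^G$ the uniform distribution on $R^G_{u,v}$ (each mass $1/(1+\deg_G(v))$). The linear program (LP) has variables $z_{x,y}\ge 0$ for $x\in L^G_{u,v},y\in R^G_{u,v}$, minimizes $\sum_{x,y}\mathrm{dist}_G(x,y)z_{x,y}$ subject to $\sum_y z_{x,y}=\mathbb{P}_u^G(x)$ for all $x$ and $\sum_x z_{x,y}=\mathbb{P}_v^G(y)$ for all $y$; its optimal value is the earth mover's distance $\mathrm{EMD}_{G_{u,v}}(\mathbb{P}_u^G,\mathbb{P}_v^G)$. MPMCT (minimum weight perfect matching on complete bipartite graphs with ternary weights): given a complete edge-weighted bipartite graph $H=(A,B,w)$ with $|A|=|B|$ and $w:A\times B\to\{1,2,3\}$, its value is $|\mathcal{M}|/|A|$, where $|\mathcal{M}|$ is the total weight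 of a minimum-weight perfect matching of $H$. For a minimization quantity with optimal value $\mathsf{OPT}$, an $(\alpha,\varepsilon)$-estimate is (produced by a polynomial-time algorithm and is) a value $\beta$ with $\mathsf{OPT}\le\beta\le\alpha\,\mathsf{OPT}+\varepsilon$.
   Formalization: The additive error ε is assumed nonnegative; for negative ε (e.g. α = 2, ε = −1) MPMCT can be (α,ε)-estimated exactly, but no estimate exists when the earth mover's distance is 0, as for a single edge. *)

theory Defs
  imports Complex_Main "HOL-Library.Landau_Symbols"
begin

section \<open>Graphs\<close>

definition simple_graph :: "'a set \<Rightarrow> 'a set set \<Rightarrow> bool" where
  "simple_graph V E \<longleftrightarrow> finite V \<and> (\<forall>e\<in>E. e \<subseteq> V \<and> card e = 2)"

definition nbr :: "'a set set \<Rightarrow> 'a \<Rightarrow> 'a set" where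
  "nbr E x = {y. {x, y} \<in> E}"

definition deg :: "'a set set \<Rightarrow> 'a \<Rightarrow> nat" where
  "deg E x = card (nbr E x)"

text \<open>Length of a shortest walk, hence of a shortest path. The value is unspecified
  if there is no walk from x to y; this does not occur below, where distances are only taken
  between the closed neighbourhoods of two adjacent vertices.\<close>

definition gdist :: "'a set set \<Rightarrow> 'a \<Rightarrow> 'a \<Rightarrow> nat" where
  "gdist E x y = (LEAST n. (x, y) \<in> {(a, b). {a, b} \<in> E} ^^ n)"

text \<open>The bipartite graph of an edge {u,v} has the closed neighbourhoods of u and v as its two
  sides and weight function \<^term>\<open>gdist E\<close>. The sides overlap as vertex sets; they
  are kept apart by the order of the arguments of the weight function.\<close>

definition closed_nbr :: "'a set set \<Rightarrow> 'a \<Rightarrow> 'a set" where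
  "closed_nbr E x = insert x (nbr E x)"

section \<open>Earth mover's distance\<close>

definition transport_plan ::
    "'a set \<Rightarrow> 'b set \<Rightarrow> ('a \<Rightarrow> real) \<Rightarrow> ('b \<Rightarrow> real) \<Rightarrow> ('a \<Rightarrow> 'b \<Rightarrow> real) \<Rightarrow> bool" where
  "transport_plan L R p q z \<longleftrightarrow>
     (\<forall>x\<in>L. \<forall>y\<in>R. z x y \<ge> 0) \<and>
     (\<forall>x\<in>L. (\<Sum>y\<in>R. z x y) = p x) \<and>
     (\<forall>y\<in>R. (\<Sum>x\<in>L. z x y) = q y)"

definition EMD ::
    "'a set \<Rightarrow> 'b set \<Rightarrow> ('a \<Rightarrow> 'b \<Rightarrow> nat) \<Rightarrow> ('a \<Rightarrow> real) \<Rightarrow> ('b \<Rightarrow> real) \<Rightarrow> real" where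
  "EMD L R w p q = (INF z\<in>{z. transport_plan L R p q z}. \<Sum>x\<in>L. \<Sum>y\<in>R. real (w x y) * z x y)"

definition edge_EMD :: "'a set set \<Rightarrow> 'a \<Rightarrow> 'a \<Rightarrow> real" where
  "edge_EMD E u v = EMD (closed_nbr E u) (closed_nbr E v) (gdist E)
     (\<lambda>_. 1 / (1 + real (deg E u))) (\<lambda>_. 1 / (1 + real (deg E v)))"

section \<open>Minimum weight perfect matching with ternary weights\<close>

definition mpmct_instance :: "'a set \<Rightarrow> 'b set \<Rightarrow> ('a \<Rightarrow> 'b \<Rightarrow> nat) \<Rightarrow> bool" where
  "mpmct_instance A B w \<longleftrightarrow> finite A \<and> finite B \<and> A \<noteq> {} \<and> card A = card B \<and>
     (\<forall>a\<in>A. \<forall>b\<in>B. w a b \<in> {1, 2, 3})"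

definition perfect_matching :: "'a set \<Rightarrow> 'b set \<Rightarrow> ('a \<times> 'b) set \<Rightarrow> bool" where
  "perfect_matching A B M \<longleftrightarrow> M \<subseteq> A \<times> B \<and>
     (\<forall>a\<in>A. \<exists>!b. (a, b) \<in> M) \<and> (\<forall>b\<in>B. \<exists>!a. (a, b) \<in> M)"

definition mpmct_value :: "'a set \<Rightarrow> 'b set \<Rightarrow> ('a \<Rightarrow> 'b \<Rightarrow> nat) \<Rightarrow> real" where
  "mpmct_value A B w =
     real (Min {\<Sum>(a, b)\<in>M. w a b | M. perfect_matching A B M}) / real (card A)"

definition is_estimate :: "real \<Rightarrow> real \<Rightarrow> real \<Rightarrow> real \<Rightarrow> bool" where
  "is_estimate \<alpha> \<epsilon> opt \<beta> \<longleftrightarrow> opt \<le> \<beta> \<and> \<beta> \<le> \<alpha> * opt + \<epsilon>"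

section \<open>A word RAM\<close>

text \<open>Algorithms are programs of a unit-cost word RAM with structured control flow. A program
  has finitely many registers (numbered by nat) and one random-access memory, addressed by
  register contents. Structured programs simulate programs with jumps with constant-factor
  overhead by keeping the program counter in a register.\<close>

datatype binop = Add | Sub | Mul | Div | Mod | BAnd | BOr | BXor | ShiftL | ShiftR

context
  includes bit_operations_syntax
begin

fun binop_val :: "binop \<Rightarrow> int \<Rightarrow> int \<Rightarrow> int" where
  "binop_val Add a b = a + b"
| "binop_val Sub a b = a - b"
| "binop_val Mul a b = a * b"
| "binop_val Div a b = a div b"
| "binop_val Mod a b = a mod b"
| "binop_val BAnd a b = a AND b"
| "binop_val BOr a b = a OR b"
| "binop_val BXor a b = a XOR b"
| "binop_val ShiftL a b = push_bit (nat b) a"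
| "binop_val ShiftR a b = drop_bit (nat b) a"

end

datatype com =
    Skip
  | Const nat int
  | Op binop nat nat nat
  | Load nat nat
  | Store nat nat
  | Seq com com
  | IfLess nat nat com com
  | WhileLess nat nat com

type_synonym state = "(nat \<Rightarrow> int) \<times> (int \<Rightarrow> int)"

text \<open>The relation \<open>exec W c s t s'\<close>: started in s, the program c terminates in s' after t
  unit-cost steps, and every value it creates has absolute value at most W. A step creating a
  larger value is stuck, so that large numbers cannot be used to hide work.\<close>

inductive exec :: "int \<Rightarrow> com \<Rightarrow> state \<Rightarrow> nat \<Rightarrow> state \<Rightarrow> bool" for W where
  Skip: "exec W Skip s 1 s"
| Const: "\<bar>n\<bar> \<le> W \<Longrightarrow> exec W (Const x n) (R, M) 1 (R(x := n), M)"
| Op: "\<bar>binop_val f (R y) (R z)\<bar> \<le> W \<Longrightarrow>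
    exec W (Op f x y z) (R, M) 1 (R(x := binop_val f (R y) (R z)), M)"
| Load: "exec W (Load x y) (R, M) 1 (R(x := M (R y)), M)"
| Store: "exec W (Store x y) (R, M) 1 (R, M(R x := R y))"
| Seq: "exec W c1 s1 t1 s2 \<Longrightarrow> exec W c2 s2 t2 s3 \<Longrightarrow> exec W (Seq c1 c2) s1 (t1 + t2) s3"
| IfTrue: "R x < R y \<Longrightarrow> exec W c1 (R, M) t s \<Longrightarrow> exec W (IfLess x y c1 c2) (R, M) (t + 1) s"
| IfFalse: "\<not> R x < R y \<Longrightarrow> exec W c2 (R, M) t s \<Longrightarrow>
    exec W (IfLess x y c1 c2) (R, M) (t + 1) s"
| WhileFalse: "\<not> R x < R y \<Longrightarrow> exec W (WhileLess x y c) (R, M) 1 (R, M)"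
| WhileTrue: "R x < R y \<Longrightarrow> exec W c (R, M) t1 s2 \<Longrightarrow> exec W (WhileLess x y c) s2 t2 s3 \<Longrightarrow>
    exec W (WhileLess x y c) (R, M) (t1 + t2 + 1) s3"

definition enumerates :: "'a list \<Rightarrow> 'a set \<Rightarrow> bool" where
  "enumerates xs A \<longleftrightarrow> distinct xs \<and> set xs = A"

text \<open>Input format for an edge-weighted complete bipartite graph whose sides are enumerated by
  xs and ys: registers 0 and 1 hold the sizes of the two sides, the memory holds the weight
  matrix in row-major order from address 0 on, and everything else is 0.\<close>

definition bip_input :: "'a list \<Rightarrow> 'b list \<Rightarrow> ('a \<Rightarrow> 'b \<Rightarrow> nat) \<Rightarrow> state" where
  "bip_input xs ys w =
     ((\<lambda>_. 0)(0 := int (length xs), 1 := int (length ys)),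
      (\<lambda>i. if 0 \<le> i \<and> i < int (length xs * length ys)
            then int (w (xs ! (nat i div length ys)) (ys ! (nat i mod length ys)))
            else 0))"

text \<open>The program c with word-size parameter k outputs the rational number \<open>\<beta>\<close> within t steps:
  numerator and denominator are left in registers 0 and 1. The bound on word values is
  polynomial of degree k in the number of nodes, i.e. words have O(log n) bits.\<close>

definition outputs_in ::
    "nat \<Rightarrow> com \<Rightarrow> 'a list \<Rightarrow> 'b list \<Rightarrow> ('a \<Rightarrow> 'b \<Rightarrow> nat) \<Rightarrow> nat \<Rightarrow> real \<Rightarrow> bool" where
  "outputs_in k c xs ys w t \<beta> \<longleftrightarrow>
     (\<exists>R M t'. exec (int (length xs + length ys + 2) ^ k) c (bip_input xs ys w) t' (R, M) \<and>
        t' \<le> t \<and> R 1 \<noteq> 0 \<and> \<beta> = of_int (R 0) / of_int (R 1))"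

end

theory Submission
  imports Defs
begin

text \<open>Let a = deg u + 1, b = deg v + 1, k = b div a and r = b mod a, and let L and R be the closed
  neighbourhoods of u and v. Put k tokens of mass 1/b on each point of L and add r dummy tokens at
  distance 1 from everything. By the triangle inequality the common points of L and R may be served by
  their own tokens at cost 0; deleting these leaves a square instance with side \<open>R - L\<close> and weights in
  \<open>{1, 2, 3}\<close>. Its minimum, divided by b, is a lower bound for the earth mover's distance: in a transport
  plan the mass carried by the dummies pays at least 1 as well, since points of \<open>R - L\<close> are at distance
  at least 1 from L, and fractional perfect matchings are no cheaper than integral ones. Replacing each
  dummy by the mass left over on L, at distance at most 3, costs at most 2 more per dummy. So the minimum
  plus 2r, divided by b, is an upper bound. Adding the additive slack 2r/b to the estimate (and not to
  the instance) keeps it from being multiplied by \<open>\<alpha>\<close>; it vanishes if a divides b, and it is at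
  most \<open>\<delta>\<close> if deg u is small against, or close to, deg v.\<close>

section \<open>Fractional and integral perfect matchings\<close>

text \<open>The matching program is a black box. It is guaranteed to work only on nonempty square
  instances with weights 1, 2, 3, started in exactly the prescribed machine state and under its own
  word bound. Distance 0 is therefore the combinatorial obstacle: common points have to leave the
  instance without a matching being computed, and the zeros of the weight matrix already name them,
  so one pass over the matrix finds them. The whole reduction takes
  \<open>O((b + 1)\<^sup>2)\<close> steps, which is affordable only because the exponent 2 + \<mu>
  is at least 2. The other obstacles concern the machine. Data of the surrounding program must
  survive in registers that the black box never touches, while the memory must look freshly
  initialised. The answer is rescaled as an exact fraction, so numerator and denominator need a
  bound that is polynomial in the size of the original graph. Finally, the size n of the instance
  can be anything up to b and the given time bound need not be monotone, so it is replaced by its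
  maximum over all sizes up to b.\<close>

theorem hall:
  assumes "finite A" "\<And>a. a \<in> A \<Longrightarrow> finite (N a)"
    and "\<And>X. X \<subseteq> A \<Longrightarrow> card X \<le> card (\<Union>(N ` X))"
  shows "\<exists>f. inj_on f A \<and> (\<forall>a\<in>A. f a \<in> N a)"
  using assms
proof (induction "card A" arbitrary: A N rule: less_induct)
  case less
  show ?case
  proof (cases "A = {}")
    case True
    then show ?thesis by simp
  next
    case False
    \<comment> \<open>The argument of Halmos and Vaughan. A tight proper subset splits the problem
      in two, and the rest keeps Hall's condition once the neighbours of the tight set are removed.
      Without a tight set there is a surplus of one everywhere, so one element may be matched at
      will.\<close>
    show ?thesis
    proof (cases "\<exists>X. X \<subset> A \<and> X \<noteq> {} \<and> card (\<Union>(N ` X)) = card X")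
      case True
      then obtain X where X: "X \<subset> A" "X \<noteq> {}" "card (\<Union>(N ` X)) = card X"
        by blast
      have fX: "finite X" using X(1) less.prems(1) by (meson finite_subset psubset_imp_subset)
      have "card X < card A" using X less.prems(1) by (simp add: psubset_card_mono)
      moreover have "\<And>Y. Y \<subseteq> X \<Longrightarrow> card Y \<le> card (\<Union>(N ` Y))"
        using less.prems(3) X(1) by blast
      ultimately have "\<exists>f. inj_on f X \<and> (\<forall>a\<in>X. f a \<in> N a)"
        using less.hyps[of X N] less.prems(2) X(1) fX by blast
      then obtain f where f: "inj_on f X" "\<forall>a\<in>X. f a \<in> N a" by blast
      let ?U = "\<Union>(N ` X)"
      have "card (A - X) < card A"
        using X less.prems(1) by (intro psubset_card_mono) auto
      moreover have "card Y \<le> card (\<Union>((\<lambda>a. N a - ?U) ` Y))" if Y: "Y \<subseteq> A - X" for Y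
      proof -
        have fY: "finite Y" using Y less.prems(1) by (meson finite_Diff finite_subset)
        have "card Y + card X = card (Y \<union> X)"
          using Y fX fY by (subst card_Un_disjoint) auto
        also have "\<dots> \<le> card (\<Union>(N ` (Y \<union> X)))"
          using Y X(1) by (intro less.prems(3)) auto
        also have "\<Union>(N ` (Y \<union> X)) = \<Union>((\<lambda>a. N a - ?U) ` Y) \<union> ?U" by auto
        also have "card \<dots> \<le> card (\<Union>((\<lambda>a. N a - ?U) ` Y)) + card ?U"
          by (rule card_Un_le)
        finally show ?thesis using X(3) by simp
      qed
      ultimately have "\<exists>g. inj_on g (A - X) \<and> (\<forall>a\<in>A - X. g a \<in> N a - ?U)"
        using less.hyps[of "A - X" "\<lambda>a. N a - ?U"] less.prems(1,2) by blast
      then obtain g where g: "inj_on g (A - X)" "\<forall>a\<in>A - X. g a \<in> N a - ?U" by blast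
      define h where "h a = (if a \<in> X then f a else g a)" for a
      have "inj_on h A"
      proof (rule inj_onI)
        fix x y assume xy: "x \<in> A" "y \<in> A" "h x = h y"
        have hU: "h z \<in> ?U \<longleftrightarrow> z \<in> X" if "z \<in> A" for z
          using f(2) g(2) that by (auto simp: h_def)
        then have "x \<in> X \<longleftrightarrow> y \<in> X" using xy by metis
        then show "x = y"
          using xy inj_onD[OF f(1), of x y] inj_onD[OF g(1), of x y]
          by (auto simp: h_def)
      qed
      moreover have "\<forall>a\<in>A. h a \<in> N a" using f g by (auto simp: h_def)
      ultimately show ?thesis by blast
    next
      case slack: False
      obtain a where a: "a \<in> A" using False by blast
      have "card {a} \<le> card (\<Union>(N ` {a}))" using a by (intro less.prems(3)) auto
      then obtain y where y: "y \<in> N a" by (cases "N a = {}") auto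
      have "card (A - {a}) < card A" using a less.prems(1) by (meson card_Diff1_less)
      moreover have "card X \<le> card (\<Union>((\<lambda>a. N a - {y}) ` X))" if X: "X \<subseteq> A - {a}" for X
      proof (cases "X = {}")
        case False
        have "X \<subset> A" using X a by blast
        then have "card (\<Union>(N ` X)) \<noteq> card X" using slack False by blast
        moreover have "card X \<le> card (\<Union>(N ` X))" using X by (intro less.prems(3)) auto
        moreover have "\<Union>((\<lambda>a. N a - {y}) ` X) = \<Union>(N ` X) - {y}" by auto
        moreover have "card (\<Union>(N ` X)) - 1 \<le> card (\<Union>(N ` X) - {y})"
          by (simp add: card_Diff_singleton_if)
        ultimately show ?thesis by simp
      qed simp
      ultimately have "\<exists>g. inj_on g (A - {a}) \<and> (\<forall>x\<in>A - {a}. g x \<in> N x - {y})"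
        using less.hyps[of "A - {a}" "\<lambda>a. N a - {y}"] less.prems(1,2) by blast
      then obtain g where g: "inj_on g (A - {a})" "\<forall>x\<in>A - {a}. g x \<in> N x - {y}" by blast
      have "inj_on (g(a := y)) A"
        using g by (auto simp: inj_on_def)
      moreover have "\<forall>x\<in>A. (g(a := y)) x \<in> N x" using g y by auto
      ultimately show ?thesis by blast
    qed
  qed
qed

text \<open>Hall's condition for the support of \<open>Z\<close> is a mass count: the rows in
  \<open>X\<close> carry total mass \<open>card X * s\<close>, all of it lies in neighbouring
  columns, and each column holds only \<open>s\<close>.\<close>

lemma positive_matching_exists:
  fixes Z :: "'a \<Rightarrow> 'b \<Rightarrow> real"
  assumes "finite A" "finite B" "card A = card B" "s > 0"
    and nonneg: "\<And>a b. a \<in> A \<Longrightarrow> b \<in> B \<Longrightarrow> Z a b \<ge> 0"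
    and row: "\<And>a. a \<in> A \<Longrightarrow> (\<Sum>b\<in>B. Z a b) = s"
    and col: "\<And>b. b \<in> B \<Longrightarrow> (\<Sum>a\<in>A. Z a b) = s"
  shows "\<exists>f. bij_betw f A B \<and> (\<forall>a\<in>A. Z a (f a) > 0)"
proof -
  define N where "N a = {b \<in> B. Z a b > 0}" for a
  have "card X \<le> card (\<Union>(N ` X))" if X: "X \<subseteq> A" for X
  proof -
    let ?U = "\<Union>(N ` X)"
    have U: "?U \<subseteq> B" by (auto simp: N_def)
    have "real (card X) * s = (\<Sum>a\<in>X. \<Sum>b\<in>B. Z a b)"
      using X row by (simp add: subset_iff)
    also have "\<dots> = (\<Sum>a\<in>X. \<Sum>b\<in>?U. Z a b)"
    proof (rule sum.cong[OF refl])
      fix a assume a: "a \<in> X"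
      have "Z a b = 0" if "b \<in> B - ?U" for b
        using that a nonneg[of a b] X by (force simp: N_def)
      then show "(\<Sum>b\<in>B. Z a b) = (\<Sum>b\<in>?U. Z a b)"
        using U assms(2) by (intro sum.mono_neutral_right) auto
    qed
    also have "\<dots> = (\<Sum>b\<in>?U. \<Sum>a\<in>X. Z a b)" by (rule sum.swap)
    also have "\<dots> \<le> (\<Sum>b\<in>?U. \<Sum>a\<in>A. Z a b)"
      using U X nonneg assms(1) by (intro sum_mono sum_mono2) auto
    also have "\<dots> = real (card ?U) * s"
      using U col by (simp add: subset_iff)
    finally show ?thesis using \<open>s > 0\<close> by simp
  qed
  moreover have "finite (N a)" for a using assms(2) by (simp add: N_def)
  ultimately obtain f where f: "inj_on f A" "\<forall>a\<in>A. f a \<in> N a"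
    using hall[of A N] assms(1) by blast
  have "f ` A \<subseteq> B" using f(2) by (auto simp: N_def)
  then have "f ` A = B"
    using f(1) assms(2,3) by (simp add: card_image card_subset_eq)
  then show ?thesis using f by (auto simp: bij_betw_def N_def)
qed

text \<open>The Birkhoff--von Neumann theorem in the form needed for costs: peel off permutations
  from the support one at a time.\<close>

lemma fractional_matching_cost_ge:
  fixes Z c :: "'a \<Rightarrow> 'b \<Rightarrow> real"
  assumes "finite A" "finite B" "card A = card B"
    and "\<And>f. bij_betw f A B \<Longrightarrow> m \<le> (\<Sum>a\<in>A. c a (f a))"
    and "s \<ge> 0"
    and "\<And>a b. a \<in> A \<Longrightarrow> b \<in> B \<Longrightarrow> Z a b \<ge> 0"
    and "\<And>a. a \<in> A \<Longrightarrow> (\<Sum>b\<in>B. Z a b) = s"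
    and "\<And>b. b \<in> B \<Longrightarrow> (\<Sum>a\<in>A. Z a b) = s"
  shows "s * m \<le> (\<Sum>a\<in>A. \<Sum>b\<in>B. c a b * Z a b)"
  using assms(5-8)
proof (induction "card {(a, b). a \<in> A \<and> b \<in> B \<and> Z a b > 0}" arbitrary: Z s rule: less_induct)
  case less
  note nonneg = less.prems(2) and row = less.prems(3) and col = less.prems(4)
  have fin: "finite {(a, b). a \<in> A \<and> b \<in> B \<and> Z a b > 0}" for Z :: "'a \<Rightarrow> 'b \<Rightarrow> real"
    by (rule finite_subset[of _ "A \<times> B"]) (use assms(1,2) in auto)
  show ?case
  proof (cases "s > 0 \<and> A \<noteq> {}")
    case False
    show ?thesis
    proof (cases "A = {}")
      case True
      then have "B = {}" using assms(2,3) by simp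
      \<comment> \<open>Every function is a bijection between empty sets, so the bound on matchings
        compares \<open>m\<close> with an empty sum.\<close>
      have "m \<le> 0" using assms(4)[of undefined] True \<open>B = {}\<close> by (simp add: bij_betw_def)
      then show ?thesis using True less.prems(1) by (simp add: mult_nonneg_nonpos)
    next
      case False
      then have "s = 0" using \<open>\<not> (s > 0 \<and> A \<noteq> {})\<close> less.prems(1) by auto
      have "Z a b = 0" if "a \<in> A" "b \<in> B" for a b
        using row[OF that(1)] that nonneg assms(2) \<open>s = 0\<close> by (simp add: sum_nonneg_eq_0_iff)
      then show ?thesis using \<open>s = 0\<close> by simp
    qed
  next
    case True
    obtain f where f: "bij_betw f A B" "\<forall>a\<in>A. Z a (f a) > 0"
      using positive_matching_exists[of A B s Z] assms(1-3) True nonneg row col by blast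
    have fB: "f a \<in> B" if "a \<in> A" for a using f(1) that by (auto simp: bij_betw_def)
    \<comment> \<open>Subtracting the smallest entry along \<open>f\<close> keeps the matrix
      nonnegative and its line sums equal, now to \<open>s - l\<close>, and it empties the cell
      \<open>(a0, f a0)\<close>. The support shrinks, which drives the induction; this is also why
      \<open>s\<close> is not fixed.\<close>
    define l where "l = Min ((\<lambda>a. Z a (f a)) ` A)"
    have l_le: "l \<le> Z a (f a)" if "a \<in> A" for a
      unfolding l_def using assms(1) that by simp
    have "l \<in> (\<lambda>a. Z a (f a)) ` A"
      unfolding l_def using assms(1) True by (intro Min_in) auto
    then obtain a0 where a0: "a0 \<in> A" "Z a0 (f a0) = l" by auto
    have "l > 0" using a0 f(2) by auto
    define Z' where "Z' a b = Z a b - (if b = f a then l else 0)" for a b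
    have "{(a, b). a \<in> A \<and> b \<in> B \<and> Z' a b > 0} \<subseteq> {(a, b). a \<in> A \<and> b \<in> B \<and> Z a b > 0}"
      using \<open>l > 0\<close> by (auto simp: Z'_def split: if_splits)
    moreover have "(a0, f a0) \<notin> {(a, b). a \<in> A \<and> b \<in> B \<and> Z' a b > 0}"
      "(a0, f a0) \<in> {(a, b). a \<in> A \<and> b \<in> B \<and> Z a b > 0}"
      using a0 fB f(2) by (auto simp: Z'_def)
    ultimately have "{(a, b). a \<in> A \<and> b \<in> B \<and> Z' a b > 0} \<subset> {(a, b). a \<in> A \<and> b \<in> B \<and> Z a b > 0}"
      by blast
    then have lt: "card {(a, b). a \<in> A \<and> b \<in> B \<and> Z' a b > 0} < card {(a, b). a \<in> A \<and> b \<in> B \<and> Z a b > 0}"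
      using fin by (rule psubset_card_mono[rotated])
    have nonneg': "Z' a b \<ge> 0" if "a \<in> A" "b \<in> B" for a b
      using nonneg that l_le by (auto simp: Z'_def)
    have row': "(\<Sum>b\<in>B. Z' a b) = s - l" if "a \<in> A" for a
      using row[OF that] fB[OF that] assms(2) by (simp add: Z'_def sum_subtractf)
    have col': "(\<Sum>a\<in>A. Z' a b) = s - l" if b: "b \<in> B" for b
    proof -
      obtain a1 where a1: "a1 \<in> A" "f a1 = b" using f(1) b by (auto simp: bij_betw_def)
      have "(\<Sum>a\<in>A. if b = f a then l else 0) = (\<Sum>a\<in>A. if a = a1 then l else 0)"
        using a1 f(1) by (intro sum.cong) (auto simp: bij_betw_def inj_on_def)
      then show ?thesis using col[OF b] a1 assms(1) by (simp add: Z'_def sum_subtractf)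
    qed
    have "s - l \<ge> 0"
    proof -
      have "Z a0 (f a0) \<le> (\<Sum>b\<in>B. Z a0 b)"
        using a0 fB nonneg assms(2) by (intro member_le_sum) auto
      then show ?thesis using a0 row by simp
    qed
    from less.hyps[OF lt this nonneg' row' col']
    have "(s - l) * m \<le> (\<Sum>a\<in>A. \<Sum>b\<in>B. c a b * Z' a b)" .
    also have "\<dots> = (\<Sum>a\<in>A. (\<Sum>b\<in>B. c a b * Z a b) - l * c a (f a))"
    proof (intro sum.cong refl)
      fix a assume "a \<in> A"
      have "(\<Sum>b\<in>B. c a b * Z' a b) =
          (\<Sum>b\<in>B. c a b * Z a b) - (\<Sum>b\<in>B. if b = f a then l * c a b else 0)"
        unfolding sum_subtractf[symmetric]
        by (intro sum.cong) (auto simp: Z'_def algebra_simps)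
      also have "(\<Sum>b\<in>B. if b = f a then l * c a b else 0) = l * c a (f a)"
        using fB[OF \<open>a \<in> A\<close>] assms(2) by simp
      finally show "(\<Sum>b\<in>B. c a b * Z' a b) = (\<Sum>b\<in>B. c a b * Z a b) - l * c a (f a)" .
    qed
    also have "\<dots> = (\<Sum>a\<in>A. \<Sum>b\<in>B. c a b * Z a b) - l * (\<Sum>a\<in>A. c a (f a))"
      by (simp add: sum_subtractf sum_distrib_left)
    finally have "(s - l) * m + l * (\<Sum>a\<in>A. c a (f a)) \<le> (\<Sum>a\<in>A. \<Sum>b\<in>B. c a b * Z a b)"
      by simp
    moreover have "l * m \<le> l * (\<Sum>a\<in>A. c a (f a))"
      using \<open>l > 0\<close> assms(4)[OF f(1)] by simp
    ultimately show ?thesis by (simp add: algebra_simps)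
  qed
qed

lemma perfect_matching_iff:
  "perfect_matching A B M \<longleftrightarrow> (\<exists>f. bij_betw f A B \<and> M = (\<lambda>a. (a, f a)) ` A)"
proof
  assume M: "perfect_matching A B M"
  define f where "f a = (THE b. (a, b) \<in> M)" for a
  have f: "(a, f a) \<in> M" if "a \<in> A" for a
    using M that theI'[of "\<lambda>b. (a, b) \<in> M"] by (simp add: perfect_matching_def f_def)
  have eq: "b = f a" if "(a, b) \<in> M" for a b
    using M that f[of a] by (auto simp: perfect_matching_def)
  have "inj_on f A"
  proof (rule inj_onI)
    fix x y assume "x \<in> A" "y \<in> A" "f x = f y"
    then have "(x, f x) \<in> M" "(y, f x) \<in> M" using f by metis+
    moreover have "f x \<in> B" using M \<open>(x, f x) \<in> M\<close> by (auto simp: perfect_matching_def)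
    ultimately show "x = y" using M unfolding perfect_matching_def by blast
  qed
  moreover have "f ` A = B"
    using M f eq by (fastforce simp: perfect_matching_def image_iff)
  moreover have "M = (\<lambda>a. (a, f a)) ` A"
    using M f eq by (fastforce simp: perfect_matching_def image_iff)
  ultimately show "\<exists>f. bij_betw f A B \<and> M = (\<lambda>a. (a, f a)) ` A"
    by (auto simp: bij_betw_def)
next
  assume "\<exists>f. bij_betw f A B \<and> M = (\<lambda>a. (a, f a)) ` A"
  then obtain f where "bij_betw f A B" "M = (\<lambda>a. (a, f a)) ` A" by blast
  then show "perfect_matching A B M"
    unfolding perfect_matching_def by (auto simp: bij_betw_def inj_on_def)
qed

lemma mpmct_value_eq:
  "mpmct_value A B w =
     real (Min {\<Sum>a\<in>A. w a (f a) | f. bij_betw f A B}) / real (card A)"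
proof -
  have "(\<Sum>(a, b)\<in>(\<lambda>a. (a, f a)) ` A. w a b) = (\<Sum>a\<in>A. w a (f a))" for f
    by (subst sum.reindex) (auto simp: inj_on_def)
  then have "{\<Sum>(a, b)\<in>M. w a b | M. perfect_matching A B M} =
      {\<Sum>a\<in>A. w a (f a) | f. bij_betw f A B}"
    unfolding perfect_matching_iff by (auto; metis)
  then show ?thesis by (simp add: mpmct_value_def)
qed

lemma mpmct_value_witness:
  fixes w :: "'a \<Rightarrow> 'b \<Rightarrow> nat"
  assumes "finite A" "finite B" "card A = card B"
  obtains f where "bij_betw f A B"
    "mpmct_value A B w = real (\<Sum>a\<in>A. w a (f a)) / real (card A)"
    "\<And>g. bij_betw g A B \<Longrightarrow> (\<Sum>a\<in>A. w a (f a)) \<le> (\<Sum>a\<in>A. w a (g a))"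
proof -
  let ?X = "{\<Sum>a\<in>A. w a (f a) | f. bij_betw f A B}"
  have "?X \<noteq> {}" using finite_same_card_bij[OF assms] by auto
  \<comment> \<open>The values of \<open>f\<close> outside \<open>A\<close> are arbitrary, so there
    may be infinitely many \<open>f\<close>. Finiteness is obtained for the sums instead, which are
    naturals below the total weight.\<close>
  moreover have "?X \<subseteq> {..\<Sum>a\<in>A. \<Sum>b\<in>B. w a b}"
  proof safe
    fix f assume f: "bij_betw f A B"
    show "(\<Sum>a\<in>A. w a (f a)) \<le> (\<Sum>a\<in>A. \<Sum>b\<in>B. w a b)"
      using f assms(2) by (intro sum_mono member_le_sum) (auto simp: bij_betw_def)
  qed
  then have fin: "finite ?X" by (rule finite_subset) simp
  ultimately have "Min ?X \<in> ?X" by (intro Min_in)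
  then obtain f where f: "bij_betw f A B" "Min ?X = (\<Sum>a\<in>A. w a (f a))" by blast
  moreover have "Min ?X \<le> (\<Sum>a\<in>A. w a (g a))" if "bij_betw g A B" for g
    using fin that by (intro Min_le) auto
  ultimately show ?thesis using that[of f] by (simp add: mpmct_value_eq)
qed

section \<open>Mass tokens and the square matching instance\<close>

lemma sum_mod_blocks:
  fixes g :: "nat \<Rightarrow> real"
  shows "(\<Sum>t<k * a. g (t mod a)) = real k * (\<Sum>i<a. g i)"
proof (induction k)
  case (Suc k)
  have "(\<Sum>t<Suc k * a. g (t mod a)) =
      (\<Sum>t<k * a. g (t mod a)) + (\<Sum>t\<in>{k * a..<k * a + a}. g (t mod a))"
    by (simp add: lessThan_atLeast0 sum.atLeastLessThan_concat add.commute)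
  also have "(\<Sum>t\<in>{k * a..<k * a + a}. g (t mod a)) = (\<Sum>i<a. g i)"
    using sum.shift_bounds_nat_ivl[of "\<lambda>t. g (t mod a)" 0 "k * a" a]
    by (simp add: lessThan_atLeast0 add.commute)
  finally show ?case using Suc by (simp add: algebra_simps)
qed simp

text \<open>All that is needed of the graph distance. The middle point in the triangle inequality
  has to lie on both sides, so \<open>d\<close> is evaluated only on pairs from
  \<open>set xs\<close> and \<open>set ys\<close>, which are the entries of the input
  matrix.\<close>

locale token_matching =
  fixes xs ys :: "'a list" and d :: "'a \<Rightarrow> 'a \<Rightarrow> nat"
  assumes distinct: "distinct xs" "distinct ys"
    and length: "xs \<noteq> []" "length xs \<le> length ys"
    and d_eq_0: "\<And>x y. x \<in> set xs \<Longrightarrow> y \<in> set ys \<Longrightarrow> d x y = 0 \<longleftrightarrow> x = y"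
    and d_triangle: "\<And>x y z. x \<in> set xs \<Longrightarrow> y \<in> set xs \<Longrightarrow> y \<in> set ys \<Longrightarrow> z \<in> set ys \<Longrightarrow>
          d x z \<le> d x y + d y z"
    and d_le_3: "\<And>x y. x \<in> set xs \<Longrightarrow> y \<in> set ys \<Longrightarrow> d x y \<le> 3"
begin

abbreviation "L \<equiv> set xs"
abbreviation "R \<equiv> set ys"
abbreviation "a \<equiv> length xs"
abbreviation "b \<equiv> length ys"

definition k :: nat where "k = b div a"
definition r :: nat where "r = b mod a"

text \<open>The tokens \<open>t < b\<close> carry mass \<open>1/b\<close> each. Those with \<open>t < k * a\<close> sit at a point of L,
  k of them at each point; the r others are spread over L.\<close>

definition src :: "nat \<Rightarrow> 'a" where "src t = xs ! (t mod a)"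

text \<open>A dummy is free on common points because a transport plan may serve these at distance 0;
  a charge of 1 there would break the lower bound. Once the common points are deleted, a dummy costs
  1 on every remaining target.\<close>

definition cost :: "nat \<Rightarrow> 'a \<Rightarrow> nat" where
  "cost t y = (if t < k * a then d (src t) y else if y \<in> L then 0 else 1)"

text \<open>Indices below \<open>a\<close> are the first copies of the points of \<open>L\<close>.
  By \<open>a_le\<close> they are proper tokens, so no dummy is ever deleted.\<close>

definition common :: "nat set" where "common = {t. t < a \<and> xs ! t \<in> R}"

abbreviation "tokens \<equiv> {..<b} - common"
abbreviation "plan \<equiv> transport_plan L R (\<lambda>_. 1 / real a) (\<lambda>_. 1 / real b)"
abbreviation "emd \<equiv> EMD L R d (\<lambda>_. 1 / real a) (\<lambda>_. 1 / real b)"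

lemma a_pos: "a > 0" and b_pos: "b > 0"
  using length by (auto simp: Suc_le_eq)

lemma b_eq: "b = k * a + r"
  by (simp add: k_def r_def)

lemma a_le: "a \<le> k * a"
proof -
  have "k \<ge> 1" using length a_pos by (simp add: k_def div_greater_zero_iff Suc_le_eq)
  then show ?thesis by simp
qed

lemma src_in: "src t \<in> L"
  using a_pos by (simp add: src_def)

lemma src_small: "t < a \<Longrightarrow> src t = xs ! t"
  by (simp add: src_def)

lemma card_R: "card R = b" and card_L: "card L = a"
  using distinct by (simp_all add: distinct_card)

lemma sum_copies:
  fixes g :: "'a \<Rightarrow> real"
  shows "(\<Sum>t<k * a. g (src t)) = real k * (\<Sum>x\<in>L. g x)"
proof -
  have "(\<Sum>i<a. g (xs ! i)) = (\<Sum>x\<in>L. g x)"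
    by (rule sum.reindex_bij_betw[OF bij_betw_nth]) (use distinct in auto)
  then show ?thesis
    using sum_mod_blocks[where g = "\<lambda>i. g (xs ! i)" and k = k and a = a] by (simp add: src_def)
qed

lemma sum_tokens_split:
  fixes f :: "nat \<Rightarrow> real"
  shows "(\<Sum>t<b. f t) = (\<Sum>t<k * a. f t) + (\<Sum>t\<in>{k * a..<b}. f t)"
  using b_eq by (simp add: lessThan_atLeast0 sum.atLeastLessThan_concat)

lemma common_subset_b: "common \<subseteq> {..<b}"
  using length by (auto simp: common_def)

lemma image_common: "(\<lambda>t. xs ! t) ` common = L \<inter> R"
proof -
  have "L \<inter> R = {x \<in> (\<lambda>t. xs ! t) ` {..<a}. x \<in> R}" by (auto simp: set_conv_nth)
  then show ?thesis by (auto simp: common_def)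
qed

lemma inj_common: "inj_on (\<lambda>t. xs ! t) common"
  using distinct by (auto simp: inj_on_def common_def nth_eq_iff_index_eq)

lemma card_tokens: "card tokens = card (R - L)"
proof -
  have "card common = card (L \<inter> R)"
    using card_image[OF inj_common] image_common by simp
  moreover have "R - L = R - (L \<inter> R)" by auto
  ultimately show ?thesis
    using common_subset_b card_R finite_subset[OF common_subset_b]
    by (simp add: card_Diff_subset)
qed

text \<open>Proper tokens follow the plan and dummies take the same share of every column. The
  proper tokens then pay the fraction \<open>k * a / b\<close> of the cost of \<open>z\<close>, the
  dummies at most the fraction \<open>r / b\<close>, and these fractions add up to 1.\<close>

lemma split_plan_matching:
  assumes z: "plan z"
  obtains \<sigma> where "bij_betw \<sigma> {..<b} R"
    "real (\<Sum>t<b. cost t (\<sigma> t)) \<le> real b * (\<Sum>x\<in>L. \<Sum>y\<in>R. real (d x y) * z x y)"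
proof -
  obtain \<sigma> where \<sigma>: "bij_betw \<sigma> {..<b} R"
    and opt: "\<And>\<tau>. bij_betw \<tau> {..<b} R \<Longrightarrow> (\<Sum>t<b. cost t (\<sigma> t)) \<le> (\<Sum>t<b. cost t (\<tau> t))"
    using mpmct_value_witness[of "{..<b}" R cost] card_R by auto
  \<comment> \<open>The factor \<open>a / b\<close> turns row mass \<open>1 / a\<close> into token
    mass \<open>1 / b\<close>. A column receives \<open>(b - r) / b^2\<close> from the
    \<open>k\<close> copies of each source, and the \<open>r\<close> dummies fill in the missing
    \<open>r / b^2\<close>.\<close>
  define Z where "Z t y = (if t < k * a then z (src t) y * (real a / real b) else 1 / (real b)\<^sup>2)"
    for t y
  let ?W = "\<Sum>x\<in>L. \<Sum>y\<in>R. real (d x y) * z x y"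
  have z0: "z x y \<ge> 0" and zrow: "(\<Sum>y\<in>R. z x y) = 1 / real a" if "x \<in> L" "y \<in> R" for x y
    using z that by (auto simp: transport_plan_def)
  have zcol: "(\<Sum>x\<in>L. z x y) = 1 / real b" if "y \<in> R" for y
    using z that by (auto simp: transport_plan_def)
  obtain y0 where y0: "y0 \<in> R" using b_pos by (metis length_greater_0_conv nth_mem)
  have kar: "real k * real a = real b - real r"
    using b_eq by (metis add_diff_cancel_right' of_nat_add of_nat_mult)
  have col: "(\<Sum>t<b. Z t y) = 1 / real b" if y: "y \<in> R" for y
  proof -
    have "(\<Sum>t<k * a. Z t y) = real k * (\<Sum>x\<in>L. z x y * (real a / real b))"
      by (simp add: Z_def flip: sum_copies)
    also have "\<dots> = (real b - real r) / (real b)\<^sup>2"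
      using kar by (simp flip: sum_distrib_right sum_divide_distrib add: zcol[OF y] power2_eq_square)
    finally have 1: "(\<Sum>t<k * a. Z t y) = (real b - real r) / (real b)\<^sup>2" .
    have "(\<Sum>t\<in>{k * a..<b}. Z t y) = real r / (real b)\<^sup>2"
      using b_eq by (simp add: Z_def)
    then show ?thesis
      unfolding sum_tokens_split 1 using b_pos by (simp add: field_simps power2_eq_square)
  qed
  have row: "(\<Sum>y\<in>R. Z t y) = 1 / real b" for t
  proof (cases "t < k * a")
    case True
    then have "(\<Sum>y\<in>R. Z t y) = (\<Sum>y\<in>R. z (src t) y) * (real a / real b)"
      by (simp add: Z_def flip: sum_distrib_right sum_divide_distrib)
    then show ?thesis using zrow[OF src_in y0] a_pos b_pos by (simp add: field_simps)
  next
    case False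
    then show ?thesis using card_R b_pos by (simp add: Z_def power2_eq_square)
  qed
  have "1 / real b * real (\<Sum>t<b. cost t (\<sigma> t)) \<le> (\<Sum>t\<in>{..<b}. \<Sum>y\<in>R. real (cost t y) * Z t y)"
  proof (rule fractional_matching_cost_ge)
    show "real (\<Sum>t<b. cost t (\<sigma> t)) \<le> (\<Sum>t\<in>{..<b}. real (cost t (\<tau> t)))"
      if "bij_betw \<tau> {..<b} R" for \<tau> using opt[OF that] by (metis of_nat_le_iff of_nat_sum)
    show "Z t y \<ge> 0" if "t \<in> {..<b}" "y \<in> R" for t y
      using z0[OF src_in] that by (simp add: Z_def)
  qed (use card_R row col in auto)
  also have "\<dots> = (\<Sum>t<k * a. \<Sum>y\<in>R. real (cost t y) * Z t y) +
      (\<Sum>t\<in>{k * a..<b}. \<Sum>y\<in>R. real (cost t y) * Z t y)" by (rule sum_tokens_split)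
  also have "(\<Sum>t<k * a. \<Sum>y\<in>R. real (cost t y) * Z t y) =
      (\<Sum>t<k * a. \<Sum>y\<in>R. real (d (src t) y) * (z (src t) y * (real a / real b)))"
    by (simp add: Z_def cost_def)
  also have "\<dots> = real k * (\<Sum>x\<in>L. \<Sum>y\<in>R. real (d x y) * (z x y * (real a / real b)))"
    by (rule sum_copies)
  also have "\<dots> = (real k * real a / real b) * ?W"
    by (simp add: sum_distrib_left sum_divide_distrib mult_ac)
  also have "(\<Sum>t\<in>{k * a..<b}. \<Sum>y\<in>R. real (cost t y) * Z t y) =
      real r * (\<Sum>y\<in>R. (if y \<in> L then 0 else 1) * (1 / (real b)\<^sup>2))"
  proof -
    have "(\<Sum>y\<in>R. real (cost t y) * Z t y) = (\<Sum>y\<in>R. (if y \<in> L then 0 else 1) * (1 / (real b)\<^sup>2))"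
      if "t \<in> {k * a..<b}" for t
      using that by (intro sum.cong) (auto simp: cost_def Z_def)
    then have "(\<Sum>t\<in>{k * a..<b}. \<Sum>y\<in>R. real (cost t y) * Z t y) =
       (\<Sum>t\<in>{k * a..<b}. \<Sum>y\<in>R. (if y \<in> L then 0 else 1) * (1 / (real b)\<^sup>2))"
      by (rule sum.cong[OF refl])
    then show ?thesis using b_eq by simp
  qed
  \<comment> \<open>Reading \<open>1 / b\<close> as the column sum of \<open>z\<close> identifies
    the cost of the dummies with a multiple of the mass that the plan sends to points outside
    \<open>L\<close>. That mass travels at least distance 1.\<close>
  also have "\<dots> = real r / real b * (\<Sum>y\<in>R. if y \<in> L then 0 else \<Sum>x\<in>L. z x y)"
    unfolding sum_distrib_left by (intro sum.cong) (auto simp: zcol power2_eq_square)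
  also have "(real k * real a / real b) * ?W + \<dots> \<le> (real k * real a / real b) * ?W + real r / real b * ?W"
  proof -
    have "(if y \<in> L then 0 else \<Sum>x\<in>L. z x y) \<le> (\<Sum>x\<in>L. real (d x y) * z x y)" if y: "y \<in> R" for y
    proof (cases "y \<in> L")
      case False
      have "1 * z x y \<le> real (d x y) * z x y" if "x \<in> L" for x
        using d_eq_0[OF that y] that False z0[OF that y]
        by (intro mult_right_mono) (auto simp: Suc_le_eq)
      then show ?thesis using False by (auto intro: sum_mono)
    qed (use z0 y in \<open>auto intro: sum_nonneg\<close>)
    then have "(\<Sum>y\<in>R. if y \<in> L then 0 else \<Sum>x\<in>L. z x y) \<le> (\<Sum>y\<in>R. \<Sum>x\<in>L. real (d x y) * z x y)"
      by (rule sum_mono)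
    also have "\<dots> = ?W" by (rule sum.swap)
    finally show ?thesis by (intro add_left_mono mult_left_mono) auto
  qed
  also have "\<dots> = ?W"
    using b_pos by (simp add: kar flip: distrib_right add_divide_distrib)
  finally have "real (\<Sum>t<b. cost t (\<sigma> t)) \<le> real b * ?W"
    using b_pos by (simp add: field_simps)
  then show ?thesis using that \<sigma> by blast
qed

text \<open>By the triangle inequality, exchanging two targets saturates a common point for free.\<close>

lemma uncross:
  assumes "bij_betw \<sigma>0 {..<b} R" and "finite S" "S \<subseteq> common"
  shows "\<exists>\<sigma>. bij_betw \<sigma> {..<b} R \<and> (\<forall>t\<in>S. \<sigma> t = xs ! t) \<and>
    (\<Sum>t<b. cost t (\<sigma> t)) \<le> (\<Sum>t<b. cost t (\<sigma>0 t))"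
  using assms(2,3)
proof (induction S rule: finite_induct)
  case empty
  then show ?case using assms(1) by auto
next
  case (insert t S)
  then obtain \<sigma> where \<sigma>: "bij_betw \<sigma> {..<b} R" "\<forall>t\<in>S. \<sigma> t = xs ! t"
    "(\<Sum>t<b. cost t (\<sigma> t)) \<le> (\<Sum>t<b. cost t (\<sigma>0 t))" by auto
  let ?y = "xs ! t"
  have t: "t < a" "?y \<in> R" using insert.prems by (auto simp: common_def)
  then have tb: "t < b" using length by simp
  show ?case
  proof (cases "\<sigma> t = ?y")
    case True
    then show ?thesis using \<sigma> by (intro exI[of _ \<sigma>]) auto
  next
    case False
    obtain s where s: "s < b" "\<sigma> s = ?y" using \<sigma>(1) t(2) unfolding bij_betw_def by (metis imageE lessThan_iff)
    have st: "s \<noteq> t" using False s by auto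
    have "s \<notin> S"
    proof
      assume "s \<in> S"
      then have "xs ! s = xs ! t" "s < a" using \<sigma>(2) s insert.prems by (auto simp: common_def)
      then show False using st t distinct by (simp add: nth_eq_iff_index_eq)
    qed
    define \<sigma>' where "\<sigma>' = \<sigma>(t := ?y, s := \<sigma> t)"
    have "inj_on \<sigma>' {..<b}"
    proof (rule inj_onI)
      fix u v assume uv: "u \<in> {..<b}" "v \<in> {..<b}" "\<sigma>' u = \<sigma>' v"
      have inj: "\<sigma> u = \<sigma> v \<longleftrightarrow> u = v" if "u < b" "v < b" for u v
        using \<sigma>(1) that by (auto simp: bij_betw_def inj_on_def)
      show "u = v"
        using uv inj[of u v] inj[of t u] inj[of t v] inj[of s u] inj[of s v] s tb st
        by (auto simp: \<sigma>'_def split: if_splits)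
    qed
    moreover have "\<sigma>' ` {..<b} \<subseteq> R"
      using \<sigma>(1) t tb by (auto simp: bij_betw_def \<sigma>'_def)
    ultimately have bij: "bij_betw \<sigma>' {..<b} R"
      unfolding bij_betw_def using card_R card_image[of \<sigma>' "{..<b}"]
      by (simp add: card_subset_eq)
    have fix_S: "\<forall>u\<in>insert t S. \<sigma>' u = xs ! u"
      using \<sigma>(2) \<open>s \<notin> S\<close> st insert.hyps by (auto simp: \<sigma>'_def)
    have split: "(\<Sum>u<b. f u) = f t + (f s + (\<Sum>u\<in>{..<b} - {t} - {s}. f u))" for f :: "nat \<Rightarrow> nat"
      using sum.remove[of "{..<b}" t f] sum.remove[of "{..<b} - {t}" s f] tb s st by simp
    have rest: "(\<Sum>u\<in>{..<b} - {t} - {s}. cost u (\<sigma>' u)) = (\<Sum>u\<in>{..<b} - {t} - {s}. cost u (\<sigma> u))"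
      by (intro sum.cong) (auto simp: \<sigma>'_def)
    have yL: "?y \<in> L" using t by simp
    have \<sigma>t: "\<sigma> t \<in> R" using \<sigma>(1) tb by (auto simp: bij_betw_def)
    have tka: "t < k * a" using t(1) a_le by (rule less_le_trans)
    have "cost t ?y = 0" using tka t yL d_eq_0 by (simp add: cost_def src_small)
    moreover have "cost s (\<sigma> t) \<le> cost s ?y + cost t (\<sigma> t)"
    proof (cases "s < k * a")
      case True
      then show ?thesis
        using tka t yL d_triangle[OF src_in yL t(2) \<sigma>t] by (simp add: cost_def src_small)
    next
      \<comment> \<open>A dummy has no position to which the triangle inequality could apply. Its
        new cost is at most 1, however, and \<open>t\<close> was paying at least 1 at a point other
        than its own.\<close>
      case s_dummy: False
      have "d ?y (\<sigma> t) \<noteq> 0" using d_eq_0[OF yL \<sigma>t] False by auto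
      then show ?thesis using s_dummy tka t yL by (simp add: cost_def src_small)
    qed
    ultimately have "(\<Sum>u<b. cost u (\<sigma>' u)) \<le> (\<Sum>u<b. cost u (\<sigma> u))"
      unfolding split rest using st s by (simp add: \<sigma>'_def)
    then show ?thesis using bij fix_S \<sigma>(3) by (intro exI[of _ \<sigma>']) auto
  qed
qed

lemma matching_le_plan:
  assumes "plan z"
  obtains \<tau> where "bij_betw \<tau> tokens (R - L)"
    "real (\<Sum>t\<in>tokens. cost t (\<tau> t)) \<le> real b * (\<Sum>x\<in>L. \<Sum>y\<in>R. real (d x y) * z x y)"
proof -
  obtain \<sigma>0 where \<sigma>0: "bij_betw \<sigma>0 {..<b} R"
    "real (\<Sum>t<b. cost t (\<sigma>0 t)) \<le> real b * (\<Sum>x\<in>L. \<Sum>y\<in>R. real (d x y) * z x y)"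
    using split_plan_matching[OF assms] .
  obtain \<sigma> where \<sigma>: "bij_betw \<sigma> {..<b} R" "\<forall>t\<in>common. \<sigma> t = xs ! t"
    "(\<Sum>t<b. cost t (\<sigma> t)) \<le> (\<Sum>t<b. cost t (\<sigma>0 t))"
    using uncross[OF \<sigma>0(1)] common_subset_b finite_subset by (metis finite_lessThan subset_refl)
  have "\<sigma> ` common = L \<inter> R" using \<sigma>(2) image_common by (metis image_cong)
  then have "\<sigma> ` tokens = R - L"
    using \<sigma>(1) common_subset_b by (auto simp: bij_betw_def inj_on_image_set_diff[where C = "{..<b}"])
  then have "bij_betw \<sigma> tokens (R - L)"
    using \<sigma>(1) by (auto simp: bij_betw_def intro: inj_on_subset)
  moreover have "(\<Sum>t\<in>tokens. cost t (\<sigma> t)) \<le> (\<Sum>t<b. cost t (\<sigma> t))"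
    by (intro sum_mono2) auto
  then have "real (\<Sum>t\<in>tokens. cost t (\<sigma> t)) \<le> real (\<Sum>t<b. cost t (\<sigma>0 t))"
    using \<sigma>(3) by (simp del: of_nat_sum)
  ultimately show ?thesis using that \<sigma>0(2) by fastforce
qed

lemma plan_of_matching:
  assumes \<tau>: "bij_betw \<tau> tokens (R - L)"
  obtains z where "plan z"
    "real b * (\<Sum>x\<in>L. \<Sum>y\<in>R. real (d x y) * z x y) \<le> real (\<Sum>t\<in>tokens. cost t (\<tau> t)) + 2 * real r"
proof -
  define \<sigma> where "\<sigma> t = (if t \<in> common then xs ! t else \<tau> t)" for t
  have \<sigma>: "bij_betw \<sigma> {..<b} R"
  proof -
    have "bij_betw \<sigma> common (L \<inter> R)"
      using inj_common image_common by (auto simp: bij_betw_def \<sigma>_def inj_on_def)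
    moreover have "bij_betw \<sigma> tokens (R - L)"
      using \<tau> by (subst bij_betw_cong[of _ _ \<tau>]) (auto simp: \<sigma>_def)
    ultimately have "bij_betw \<sigma> (common \<union> tokens) ((L \<inter> R) \<union> (R - L))"
      by (rule bij_betw_combine) auto
    moreover have "common \<union> tokens = {..<b}" using common_subset_b by auto
    moreover have "(L \<inter> R) \<union> (R - L) = R" by auto
    ultimately show ?thesis by simp
  qed
  \<comment> \<open>Where token \<open>t\<close> draws its mass. After \<open>k\<close> tokens of
    mass \<open>1 / b\<close> each source has \<open>1 / a - k / b = r / (a * b)\<close> left, which
    is what \<open>r\<close> uniformly spread dummies consume.\<close>
  define P where "P t x = (if t < k * a then if x = src t then 1 / real b else 0
      else 1 / (real a * real b))" for t x
  define z where "z x y = (\<Sum>t<b. if \<sigma> t = y then P t x else 0)" for x y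
  have Psum: "(\<Sum>x\<in>L. P t x) = 1 / real b" for t
    using src_in[of t] card_L a_pos by (cases "t < k * a") (simp_all add: P_def)
  have \<sigma>R: "\<sigma> t \<in> R" if "t < b" for t using \<sigma> that by (auto simp: bij_betw_def)
  have sum_z: "(\<Sum>y\<in>R. f y * z x y) = (\<Sum>t<b. f (\<sigma> t) * P t x)" for f x
  proof -
    have "(\<Sum>y\<in>R. f y * z x y) = (\<Sum>t<b. \<Sum>y\<in>R. if \<sigma> t = y then f y * P t x else 0)"
      unfolding z_def sum_distrib_left by (subst sum.swap) (auto intro!: sum.cong)
    also have "\<dots> = (\<Sum>t<b. f (\<sigma> t) * P t x)"
      using \<sigma>R by (intro sum.cong) auto
    finally show ?thesis .
  qed
  have "plan z"
    unfolding transport_plan_def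
  proof (intro conjI ballI)
    show "z x y \<ge> 0" for x y
      unfolding z_def P_def by (intro sum_nonneg) auto
    show "(\<Sum>x\<in>L. z x y) = 1 / real b" if y: "y \<in> R" for y
    proof -
      obtain s where s: "s < b" "\<sigma> s = y" using \<sigma> y unfolding bij_betw_def by (metis imageE lessThan_iff)
      have "(\<Sum>x\<in>L. z x y) = (\<Sum>t<b. \<Sum>x\<in>L. if \<sigma> t = y then P t x else 0)"
        unfolding z_def by (rule sum.swap)
      also have "\<dots> = (\<Sum>t<b. if t = s then 1 / real b else 0)"
      proof (rule sum.cong[OF refl])
        fix t assume "t \<in> {..<b}"
        then have "\<sigma> t = y \<longleftrightarrow> t = s" using s \<sigma> by (auto simp: bij_betw_def inj_on_def)
        then show "(\<Sum>x\<in>L. if \<sigma> t = y then P t x else 0) = (if t = s then 1 / real b else 0)"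
          using Psum by simp
      qed
      finally show ?thesis using s by simp
    qed
    show "(\<Sum>y\<in>R. z x y) = 1 / real a" if x: "x \<in> L" for x
    proof -
      have "(\<Sum>y\<in>R. z x y) = (\<Sum>t<b. P t x)" using sum_z[of "\<lambda>_. 1" x] by simp
      also have "\<dots> = (\<Sum>t<k * a. if x = src t then 1 / real b else 0) +
          (\<Sum>t\<in>{k * a..<b}. 1 / (real a * real b))"
        unfolding sum_tokens_split by (simp add: P_def)
      also have "\<dots> = real k / real b + real r / (real a * real b)"
        using sum_copies[of "\<lambda>y. if x = y then 1 / real b else 0"] x b_eq by simp
      also have "\<dots> = real (k * a + r) / (real a * real b)"
        using a_pos b_pos by (simp add: field_simps)
      also have "\<dots> = 1 / real a"
        unfolding b_eq[symmetric] using b_pos by simp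
      finally show ?thesis .
    qed
  qed
  moreover have "real b * (\<Sum>x\<in>L. \<Sum>y\<in>R. real (d x y) * z x y)
      \<le> real (\<Sum>t\<in>tokens. cost t (\<tau> t)) + 2 * real r"
  proof -
    have "(\<Sum>x\<in>L. \<Sum>y\<in>R. real (d x y) * z x y) = (\<Sum>t<b. \<Sum>x\<in>L. real (d x (\<sigma> t)) * P t x)"
      unfolding sum_z[of "\<lambda>y. real (d _ y)"] by (rule sum.swap)
    also have "\<dots> \<le> (\<Sum>t<b. 1 / real b * ((if t \<in> common then 0 else real (cost t (\<tau> t))) +
        (if k * a \<le> t then 2 else 0)))"
    proof (rule sum_mono)
      fix t assume t: "t \<in> {..<b}"
      show "(\<Sum>x\<in>L. real (d x (\<sigma> t)) * P t x) \<le> 1 / real b *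
          ((if t \<in> common then 0 else real (cost t (\<tau> t))) + (if k * a \<le> t then 2 else 0))"
      proof (cases "t < k * a")
        case True
        have "(\<Sum>x\<in>L. real (d x (\<sigma> t)) * P t x) =
            (\<Sum>x\<in>L. if x = src t then real (d (src t) (\<sigma> t)) / real b else 0)"
          using True by (intro sum.cong) (auto simp: P_def)
        also have "\<dots> = real (d (src t) (\<sigma> t)) / real b" using src_in by simp
        finally show ?thesis
          using True by (auto simp: \<sigma>_def cost_def common_def src_small d_eq_0[THEN iffD2])
      next
        case False
        then have nc: "t \<notin> common"
          using less_le_trans[OF _ a_le, of t] by (auto simp: common_def)
        then have "\<tau> t \<in> R - L" using t \<tau> by (auto simp: bij_betw_def)
        \<comment> \<open>The dummy is matched outside \<open>L\<close>, so 1 of its at most 3 units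
          of distance is already paid in the matching; this leaves the surcharge of 2.\<close>
        then have c1: "cost t (\<tau> t) = 1" using False by (simp add: cost_def)
        have "(\<Sum>x\<in>L. real (d x (\<sigma> t)) * P t x) \<le> (\<Sum>x\<in>L. 3 * P t x)"
          using d_le_3 \<sigma>R t by (intro sum_mono mult_right_mono) (auto simp: P_def)
        also have "\<dots> = 3 / real b" using Psum by (simp flip: sum_distrib_left)
        finally show ?thesis using False nc c1 by simp
      qed
    qed
    also have "\<dots> = 1 / real b * ((\<Sum>t<b. if t \<in> common then 0 else real (cost t (\<tau> t))) +
        (\<Sum>t<b. if k * a \<le> t then 2 else 0))"
      unfolding sum_distrib_left[symmetric] sum.distrib ..
    also have "(\<Sum>t<b. if t \<in> common then 0 else real (cost t (\<tau> t))) = (\<Sum>t\<in>tokens. real (cost t (\<tau> t)))"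
      by (intro sum.mono_neutral_cong_right) auto
    also have "(\<Sum>t<b. if k * a \<le> t then 2 else 0 :: real) = 2 * real r"
      unfolding sum_tokens_split using b_eq by simp
    finally show ?thesis using b_pos by (simp add: field_simps)
  qed
  ultimately show ?thesis using that by blast
qed

lemma plan_cost_nonneg: "plan z \<Longrightarrow> (\<Sum>x\<in>L. \<Sum>y\<in>R. real (d x y) * z x y) \<ge> 0"
  by (intro sum_nonneg) (auto simp: transport_plan_def)

lemma plan_exists: "\<exists>z. plan z"
proof -
  obtain \<tau> where "bij_betw \<tau> tokens (R - L)"
    using finite_same_card_bij[OF _ _ card_tokens] by auto
  then show ?thesis using plan_of_matching by blast
qed

lemma emd_le: "plan z \<Longrightarrow> emd \<le> (\<Sum>x\<in>L. \<Sum>y\<in>R. real (d x y) * z x y)"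
  unfolding EMD_def
  by (rule cINF_lower) (auto intro!: bdd_belowI[of _ 0] plan_cost_nonneg)

lemma emd_ge:
  assumes "\<And>z. plan z \<Longrightarrow> m \<le> (\<Sum>x\<in>L. \<Sum>y\<in>R. real (d x y) * z x y)"
  shows "m \<le> emd"
  unfolding EMD_def using plan_exists assms by (intro cINF_greatest) auto

context
  fixes rows cols :: "nat list"
  assumes rows: "distinct rows" "set rows = tokens"
    and cols: "distinct cols" "set cols = {j. j < b \<and> ys ! j \<notin> L}"
begin

text \<open>Positions in the two lists serve as vertices because the matching program is only known
  to handle sides that are sets of naturals. The lists stay arbitrary so that the ones produced by
  the program can be inserted.\<close>

definition w :: "nat \<Rightarrow> nat \<Rightarrow> nat" where
  "w p q = (if rows ! p < k * a then d (xs ! (rows ! p mod a)) (ys ! (cols ! q)) else 1)"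

abbreviation "n \<equiv> length rows"

lemma bij_rows: "bij_betw (\<lambda>p. rows ! p) {..<n} tokens"
  by (rule bij_betw_nth) (use rows in auto)

lemma bij_cols: "bij_betw (\<lambda>q. ys ! (cols ! q)) {..<length cols} (R - L)"
proof -
  have "bij_betw (\<lambda>q. cols ! q) {..<length cols} (set cols)"
    by (rule bij_betw_nth) (use cols in auto)
  moreover have "bij_betw (\<lambda>j. ys ! j) (set cols) (R - L)"
    using cols distinct by (auto simp: bij_betw_def inj_on_def nth_eq_iff_index_eq in_set_conv_nth)
  ultimately show ?thesis
    using bij_betw_trans by (fastforce simp: comp_def)
qed

lemma length_rows_cols: "length cols = n"
  using bij_betw_same_card[OF bij_rows] bij_betw_same_card[OF bij_cols] card_tokens by simp

lemma n_le: "n \<le> b"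
  using rows distinct_card[OF rows(1)] card_mono[of "{..<b}" tokens] by auto

lemma cols_in: "q < n \<Longrightarrow> ys ! (cols ! q) \<in> R - L"
  using bij_cols length_rows_cols by (auto simp: bij_betw_def)

lemma w_eq_cost: "q < n \<Longrightarrow> w p q = cost (rows ! p) (ys ! (cols ! q))"
  using cols_in by (auto simp: w_def cost_def src_def)

text \<open>This is what the deletion of the common points was for: no column lies in
  \<open>L\<close>, so distance 0 cannot occur.\<close>

lemma w_range: "q < n \<Longrightarrow> w p q \<in> {1, 2, 3}"
  using cols_in[of q] d_eq_0[of "xs ! (rows ! p mod a)" "ys ! (cols ! q)"]
    d_le_3[of "xs ! (rows ! p mod a)" "ys ! (cols ! q)"] a_pos
  unfolding w_def by (cases "d (xs ! (rows ! p mod a)) (ys ! (cols ! q))") (auto split: if_splits)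

lemma mpmct_instance_w: "n > 0 \<Longrightarrow> mpmct_instance {..<n} {..<n} w"
  using w_range by (auto simp: mpmct_instance_def)

lemma matching_transfer:
  assumes \<tau>: "bij_betw \<tau> tokens (R - L)"
  obtains f where "bij_betw f {..<n} {..<n}"
    "(\<Sum>p<n. w p (f p)) = (\<Sum>t\<in>tokens. cost t (\<tau> t))"
proof -
  define f where "f p = the_inv_into {..<n} (\<lambda>q. ys ! (cols ! q)) (\<tau> (rows ! p))" for p
  note bc = bij_cols[unfolded length_rows_cols]
  have "bij_betw (the_inv_into {..<n} (\<lambda>q. ys ! (cols ! q)) \<circ> (\<tau> \<circ> (\<lambda>p. rows ! p))) {..<n} {..<n}"
    by (intro bij_betw_trans[OF bij_betw_trans[OF bij_rows \<tau>]] bij_betw_the_inv_into[OF bc])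
  then have f: "bij_betw f {..<n} {..<n}" unfolding f_def comp_def .
  have "w p (f p) = cost (rows ! p) (\<tau> (rows ! p))" if p: "p < n" for p
  proof -
    have "rows ! p \<in> tokens" using bij_rows p by (auto simp: bij_betw_def)
    then have "\<tau> (rows ! p) \<in> R - L" using \<tau> by (auto simp: bij_betw_def)
    then have "ys ! (cols ! (f p)) = \<tau> (rows ! p)"
      unfolding f_def by (intro f_the_inv_into_f_bij_betw[OF bc]) auto
    moreover have "f p < n" using f p by (auto simp: bij_betw_def)
    ultimately show ?thesis by (simp add: w_eq_cost)
  qed
  then have "(\<Sum>p<n. w p (f p)) = (\<Sum>p<n. cost (rows ! p) (\<tau> (rows ! p)))" by simp
  also have "\<dots> = (\<Sum>t\<in>tokens. cost t (\<tau> t))"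
    by (rule sum.reindex_bij_betw[OF bij_rows])
  finally show ?thesis using that f by blast
qed

lemma matching_transfer_back:
  assumes f: "bij_betw f {..<n} {..<n}"
  obtains \<tau> where "bij_betw \<tau> tokens (R - L)"
    "(\<Sum>t\<in>tokens. cost t (\<tau> t)) = (\<Sum>p<n. w p (f p))"
proof -
  define \<tau> where "\<tau> t = ys ! (cols ! (f (the_inv_into {..<n} (\<lambda>p. rows ! p) t)))" for t
  have "bij_betw ((\<lambda>q. ys ! (cols ! q)) \<circ> (f \<circ> the_inv_into {..<n} (\<lambda>p. rows ! p))) tokens (R - L)"
    by (intro bij_betw_trans[OF bij_betw_trans[OF bij_betw_the_inv_into[OF bij_rows] f]]
        bij_cols[unfolded length_rows_cols])
  then have \<tau>: "bij_betw \<tau> tokens (R - L)" unfolding \<tau>_def comp_def .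
  have "(\<Sum>t\<in>tokens. cost t (\<tau> t)) = (\<Sum>p<n. cost (rows ! p) (\<tau> (rows ! p)))"
    by (rule sum.reindex_bij_betw[OF bij_rows, symmetric])
  also have "\<dots> = (\<Sum>p<n. w p (f p))"
  proof (rule sum.cong[OF refl])
    fix p assume p: "p \<in> {..<n}"
    then have "the_inv_into {..<n} (\<lambda>p. rows ! p) (rows ! p) = p"
      using bij_rows by (intro the_inv_into_f_f) (auto simp: bij_betw_def)
    moreover have "f p < n" using f p by (auto simp: bij_betw_def)
    ultimately show "cost (rows ! p) (\<tau> (rows ! p)) = w p (f p)" by (simp add: w_eq_cost \<tau>_def)
  qed
  finally show ?thesis using that \<tau> by blast
qed

text \<open>The factor \<open>n / b\<close> undoes the normalisation of the matching value by the
  number of remaining tokens and puts the token mass \<open>1 / b\<close> in its place.\<close>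

lemma emd_bounds:
  assumes "n > 0"
  shows "real n / real b * mpmct_value {..<n} {..<n} w \<le> emd"
    and "emd \<le> real n / real b * mpmct_value {..<n} {..<n} w + 2 * real r / real b"
proof -
  obtain f where f: "bij_betw f {..<n} {..<n}"
    "mpmct_value {..<n} {..<n} w = real (\<Sum>p<n. w p (f p)) / real (card {..<n})"
    "\<And>g. bij_betw g {..<n} {..<n} \<Longrightarrow> (\<Sum>p<n. w p (f p)) \<le> (\<Sum>p<n. w p (g p))"
    using mpmct_value_witness[of "{..<n}" "{..<n}" w] by auto
  have v: "real n / real b * mpmct_value {..<n} {..<n} w = real (\<Sum>p<n. w p (f p)) / real b"
    using f(2) assms by simp
  show "real n / real b * mpmct_value {..<n} {..<n} w \<le> emd"
    unfolding v
  proof (rule emd_ge)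
    fix z assume "plan z"
    then obtain \<tau> where \<tau>: "bij_betw \<tau> tokens (R - L)"
      "real (\<Sum>t\<in>tokens. cost t (\<tau> t)) \<le> real b * (\<Sum>x\<in>L. \<Sum>y\<in>R. real (d x y) * z x y)"
      by (rule matching_le_plan)
    obtain g where "bij_betw g {..<n} {..<n}" "(\<Sum>p<n. w p (g p)) = (\<Sum>t\<in>tokens. cost t (\<tau> t))"
      using matching_transfer[OF \<tau>(1)] .
    then have "real (\<Sum>p<n. w p (f p)) \<le> real (\<Sum>t\<in>tokens. cost t (\<tau> t))"
      using f(3)[of g] by (simp del: of_nat_sum)
    with \<tau>(2) show "real (\<Sum>p<n. w p (f p)) / real b \<le> (\<Sum>x\<in>L. \<Sum>y\<in>R. real (d x y) * z x y)"
      using b_pos by (simp add: field_simps)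
  qed
  obtain \<tau> where \<tau>: "bij_betw \<tau> tokens (R - L)"
    "(\<Sum>t\<in>tokens. cost t (\<tau> t)) = (\<Sum>p<n. w p (f p))"
    using matching_transfer_back[OF f(1)] .
  obtain z where z: "plan z"
    "real b * (\<Sum>x\<in>L. \<Sum>y\<in>R. real (d x y) * z x y) \<le> real (\<Sum>t\<in>tokens. cost t (\<tau> t)) + 2 * real r"
    using plan_of_matching[OF \<tau>(1)] .
  have "real b * emd \<le> real b * (\<Sum>x\<in>L. \<Sum>y\<in>R. real (d x y) * z x y)"
    using emd_le[OF z(1)] by (simp add: mult_left_mono)
  also note z(2)
  finally show "emd \<le> real n / real b * mpmct_value {..<n} {..<n} w + 2 * real r / real b"
    unfolding v \<tau>(2) using b_pos by (simp add: field_simps)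
qed

text \<open>Without rows \<open>R\<close> is contained in \<open>L\<close>, so by
  \<open>a \<le> b\<close> both sides have the same size. Then \<open>r = 0\<close>, and the empty
  matching, for which any function will do, yields a plan of cost 0.\<close>

lemma emd_eq_0:
  assumes "n = 0"
  shows "emd = 0"
proof (rule antisym)
  have T: "tokens = {}" using rows assms by simp
  have "R \<subseteq> L" using card_tokens T by simp
  then have "b \<le> a" using card_mono[of L R] card_L card_R by simp
  then have "r = 0" using length by (simp add: r_def)
  have "bij_betw undefined tokens (R - L)" unfolding T using \<open>R \<subseteq> L\<close> by (simp add: bij_betw_def)
  then obtain z where z: "plan z"
    "real b * (\<Sum>x\<in>L. \<Sum>y\<in>R. real (d x y) * z x y) \<le> real (\<Sum>t\<in>tokens. cost t (undefined t)) + 2 * real r"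
    by (rule plan_of_matching)
  then have "(\<Sum>x\<in>L. \<Sum>y\<in>R. real (d x y) * z x y) \<le> 0"
    using T \<open>r = 0\<close> b_pos by (simp add: mult_le_0_iff)
  then show "emd \<le> 0" using emd_le[OF z(1)] by simp
  show "0 \<le> emd" by (rule emd_ge) (rule plan_cost_nonneg)
qed

end

end

section \<open>Reasoning about word RAM programs\<close>

lemma exec_mono:
  assumes "exec W c s t s'" "W \<le> W'"
  shows "exec W' c s t s'"
  using assms by induction (blast intro: exec.intros order_trans)+

text \<open>Loads and stores only move values, so nothing in the final state exceeds both the word
  bound and the initial values. This bounds the fraction returned by the matching program before it
  is multiplied further.\<close>

lemma exec_bounded:
  assumes "exec W c s t s'" "W \<le> B"
    and "\<And>i. \<bar>fst s i\<bar> \<le> B" "\<And>i. \<bar>snd s i\<bar> \<le> B"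
  shows "(\<forall>i. \<bar>fst s' i\<bar> \<le> B) \<and> (\<forall>i. \<bar>snd s' i\<bar> \<le> B)"
  using assms by induction force+

fun uses_below :: "nat \<Rightarrow> com \<Rightarrow> bool" where
  "uses_below N Skip \<longleftrightarrow> True"
| "uses_below N (Const x n) \<longleftrightarrow> x < N"
| "uses_below N (Op f x y z) \<longleftrightarrow> x < N \<and> y < N \<and> z < N"
| "uses_below N (Load x y) \<longleftrightarrow> x < N \<and> y < N"
| "uses_below N (Store x y) \<longleftrightarrow> x < N \<and> y < N"
| "uses_below N (Seq c1 c2) \<longleftrightarrow> uses_below N c1 \<and> uses_below N c2"
| "uses_below N (IfLess x y c1 c2) \<longleftrightarrow> x < N \<and> y < N \<and> uses_below N c1 \<and> uses_below N c2"
| "uses_below N (WhileLess x y c) \<longleftrightarrow> x < N \<and> y < N \<and> uses_below N c"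

lemma uses_below_mono: "uses_below N c \<Longrightarrow> N \<le> N' \<Longrightarrow> uses_below N' c"
  by (induction c) auto

lemma uses_below_exists: "\<exists>N. uses_below N c"
proof (induction c)
  case (Const x n)
  then show ?case by (intro exI[of _ "Suc x"]) simp
next
  case (Op f x y z)
  then show ?case by (intro exI[of _ "Suc (x + y + z)"]) simp
next
  case (Load x y)
  then show ?case by (intro exI[of _ "Suc (x + y)"]) simp
next
  case (Store x y)
  then show ?case by (intro exI[of _ "Suc (x + y)"]) simp
next
  case (Seq c1 c2)
  then obtain N1 N2 where "uses_below N1 c1" "uses_below N2 c2" by blast
  then show ?case using uses_below_mono by (intro exI[of _ "N1 + N2"]) fastforce
next
  case (IfLess x y c1 c2)
  then obtain N1 N2 where "uses_below N1 c1" "uses_below N2 c2" by blast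
  then show ?case using uses_below_mono by (intro exI[of _ "Suc (x + y + N1 + N2)"]) fastforce
next
  case (WhileLess x y c)
  then obtain N where "uses_below N c" by blast
  then show ?case using uses_below_mono by (intro exI[of _ "Suc (x + y + N)"]) fastforce
qed auto

definition merge :: "nat \<Rightarrow> (nat \<Rightarrow> int) \<Rightarrow> (nat \<Rightarrow> int) \<Rightarrow> nat \<Rightarrow> int" where
  "merge N R Q = (\<lambda>i. if i < N then R i else Q i)"

lemma merge_upd: "x < N \<Longrightarrow> (merge N R Q)(x := v) = merge N (R(x := v)) Q"
  by (auto simp: merge_def)

lemma merge_below: "x < N \<Longrightarrow> merge N R Q x = R x"
  by (simp add: merge_def)

text \<open>Allows a program analysed from its own start state to run as a subroutine: registers
  from \<open>N\<close> on neither influence it nor change. The memory is not framed, so the caller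
  has to restore it to its initial form.\<close>

lemma exec_frame:
  assumes "exec W c s t s'" "uses_below N c"
  shows "exec W c (merge N (fst s) Q, snd s) t (merge N (fst s') Q, snd s')"
  using assms
proof induction
  case (Const n x R M)
  then show ?case using exec.Const[of n W x "merge N R Q" M] by (simp add: merge_upd del: fun_upd_apply)
next
  case (Op f R y z x M)
  then show ?case using exec.Op[of f "merge N R Q" y z W x M]
    by (simp add: merge_upd merge_below del: fun_upd_apply)
next
  case (Load x y R M)
  then show ?case using exec.Load[of W x y "merge N R Q" M] by (simp add: merge_upd merge_below del: fun_upd_apply)
next
  case (Store x y R M)
  then show ?case using exec.Store[of W x y "merge N R Q" M] by (simp add: merge_below del: fun_upd_apply)
next
  case (IfTrue R x y c1 M t s c2)
  then show ?case using exec.IfTrue[of "merge N R Q" x y W c1 M t] by (simp add: merge_below)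
next
  case (IfFalse R x y c2 M t s c1)
  then show ?case using exec.IfFalse[of "merge N R Q" x y W c2 M t] by (simp add: merge_below)
next
  case (WhileFalse R x y c M)
  then show ?case using exec.WhileFalse[of "merge N R Q" x y W c M] by (simp add: merge_below)
next
  case (WhileTrue R x y c M t1 s2 t2 s3)
  then show ?case
    using exec.WhileTrue[of "merge N R Q" x y W c M t1 _ t2] by (fastforce simp: merge_below)
next
  case (Seq c1 s1 t1 s2 c2 t2 s3)
  then show ?case using exec.Seq by fastforce
qed (rule exec.Skip)

definition wp :: "int \<Rightarrow> com \<Rightarrow> nat \<Rightarrow> (state \<Rightarrow> bool) \<Rightarrow> state \<Rightarrow> bool" where
  "wp W c T Q s \<longleftrightarrow> (\<exists>t s'. t \<le> T \<and> exec W c s t s' \<and> Q s')"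

lemma wp_intro: "exec W c s t s' \<Longrightarrow> t \<le> T \<Longrightarrow> Q s' \<Longrightarrow> wp W c T Q s"
  unfolding wp_def by blast

lemma wp_weaken: "wp W c T Q s \<Longrightarrow> T \<le> T' \<Longrightarrow> (\<And>s. Q s \<Longrightarrow> Q' s) \<Longrightarrow> wp W c T' Q' s"
  unfolding wp_def by (meson le_trans)

lemma wp_Seq:
  assumes "wp W c1 T1 (wp W c2 T2 Q) s"
  shows "wp W (Seq c1 c2) (T1 + T2) Q s"
proof -
  obtain t1 s1 t2 s2 where "t1 \<le> T1" "exec W c1 s t1 s1" "t2 \<le> T2" "exec W c2 s1 t2 s2" "Q s2"
    using assms unfolding wp_def by blast
  then show ?thesis unfolding wp_def using exec.Seq by (metis add_mono)
qed

lemma wp_While: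
  assumes body: "\<And>j s. j < n \<Longrightarrow> I j s \<Longrightarrow> wp W c T (I (Suc j)) s"
    and guard: "\<And>j s. j \<le> n \<Longrightarrow> I j s \<Longrightarrow> fst s x < fst s y \<longleftrightarrow> j < n"
    and init: "I 0 s"
    and post: "\<And>s. I n s \<Longrightarrow> Q s"
  shows "wp W (WhileLess x y c) (n * (T + 1) + 1) Q s"
proof -
  have "wp W (WhileLess x y c) (m * (T + 1) + 1) Q s" if "I (n - m) s" "m \<le> n" for m s
    using that
  proof (induction m arbitrary: s)
    case 0
    then have "exec W (WhileLess x y c) s 1 s"
      using guard[of n s] exec.WhileFalse by (metis diff_zero less_irrefl order_refl prod.collapse)
    moreover have "Q s" using 0 post by simp
    ultimately show ?case unfolding wp_def by (intro exI[of _ 1] exI[of _ s]) simp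
  next
    case (Suc m)
    then have lt: "n - Suc m < n" by simp
    obtain R M where s: "s = (R, M)" by (cases s)
    obtain t1 s1 where 1: "t1 \<le> T" "exec W c s t1 s1" "I (Suc (n - Suc m)) s1"
      using body[OF lt Suc.prems(1)] unfolding wp_def by blast
    have "Suc (n - Suc m) = n - m" using Suc.prems by simp
    then obtain t2 s2 where 2: "t2 \<le> m * (T + 1) + 1" "exec W (WhileLess x y c) s1 t2 s2" "Q s2"
      using Suc.IH[of s1] 1 Suc.prems unfolding wp_def by auto
    have "R x < R y" using guard[OF _ Suc.prems(1)] lt s by simp
    then have "exec W (WhileLess x y c) s (t1 + t2 + 1) s2"
      using exec.WhileTrue 1 2 s by blast
    moreover have "t1 + t2 + 1 \<le> Suc m * (T + 1) + 1" using 1 2 by simp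
    ultimately show ?case using 2(3) unfolding wp_def by blast
  qed
  from this[of n s] show ?thesis using init by simp
qed

abbreviation seq :: "com \<Rightarrow> com \<Rightarrow> com" (infixr ";;" 60) where
  "c1 ;; c2 \<equiv> Seq c1 c2"

lemma wp_For:
  assumes "\<And>j R M. j < n \<Longrightarrow> I j R M \<Longrightarrow> wp W c T (\<lambda>s. I (Suc j) (fst s) (snd s)) (R, M)"
    and "\<And>j R M. I j R M \<Longrightarrow> R i < R l \<longleftrightarrow> j < n"
    and "I 0 (R(i := 0)) M" and "\<And>R M. I n R M \<Longrightarrow> Q (R, M)" and "0 \<le> W"
  shows "wp W (Const i 0 ;; WhileLess i l c) (n * (T + 1) + 2) Q (R, M)"
proof -
  have "wp W (WhileLess i l c) (n * (T + 1) + 1) Q (R(i := 0), M)"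
    by (rule wp_While[where I = "\<lambda>j s. I j (fst s) (snd s)"]) (use assms in auto)
  then have "wp W (Const i 0) 1 (wp W (WhileLess i l c) (n * (T + 1) + 1) Q) (R, M)"
    using assms(5) by (intro wp_intro[OF exec.Const]) auto
  from wp_Seq[OF this] show ?thesis by (simp add: add.commute)
qed

text \<open>An upper bound for loop-free commands. The operand values are premises of their own in the
  rules below, so that they are simplified before they enter the next state.\<close>

fun steps :: "com \<Rightarrow> nat" where
  "steps (Seq c1 c2) = steps c1 + steps c2"
| "steps (IfLess x y c1 c2) = steps c1 + steps c2 + 1"
| "steps _ = 1"

lemma wp_steps_le: "wp W c (steps c) Q s \<Longrightarrow> steps c \<le> T \<Longrightarrow> wp W c T Q s"
  by (rule wp_weaken)

lemma wp_Skip: "Q s \<Longrightarrow> wp W Skip (steps Skip) Q s"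
  by (rule wp_intro[OF exec.Skip]) auto

lemma wp_Const:
  "Q (R(x := n), M) \<Longrightarrow> \<bar>n\<bar> \<le> W \<Longrightarrow> wp W (Const x n) (steps (Const x n)) Q (R, M)"
  by (rule wp_intro[OF exec.Const]) auto

lemma wp_Op:
  "R y = v1 \<Longrightarrow> R z = v2 \<Longrightarrow> Q (R(x := binop_val f v1 v2), M) \<Longrightarrow> \<bar>binop_val f v1 v2\<bar> \<le> W \<Longrightarrow>
    wp W (Op f x y z) (steps (Op f x y z)) Q (R, M)"
  by (rule wp_intro[OF exec.Op]) auto

lemma wp_Load:
  "R y = v1 \<Longrightarrow> M v1 = v2 \<Longrightarrow> Q (R(x := v2), M) \<Longrightarrow> wp W (Load x y) (steps (Load x y)) Q (R, M)"
  by (rule wp_intro[OF exec.Load]) auto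

lemma wp_Store:
  "R x = v1 \<Longrightarrow> R y = v2 \<Longrightarrow> Q (R, M(v1 := v2)) \<Longrightarrow> wp W (Store x y) (steps (Store x y)) Q (R, M)"
  by (rule wp_intro[OF exec.Store]) auto

lemma wp_Seq_steps:
  "wp W c1 (steps c1) (wp W c2 (steps c2) Q) s \<Longrightarrow> wp W (Seq c1 c2) (steps (Seq c1 c2)) Q s"
  by (simp add: wp_Seq)

lemma wp_IfLess_true:
  assumes "R x < R y" "wp W c1 (steps c1) Q (R, M)"
  shows "wp W (IfLess x y c1 c2) (steps (IfLess x y c1 c2)) Q (R, M)"
proof -
  obtain t s where h: "t \<le> steps c1" "exec W c1 (R, M) t s" "Q s"
    using assms(2) unfolding wp_def by blast
  show ?thesis by (rule wp_intro[OF exec.IfTrue[OF assms(1) h(2)]]) (use h in auto)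
qed

lemma wp_IfLess_false:
  assumes "\<not> R x < R y" "wp W c2 (steps c2) Q (R, M)"
  shows "wp W (IfLess x y c1 c2) (steps (IfLess x y c1 c2)) Q (R, M)"
proof -
  obtain t s where h: "t \<le> steps c2" "exec W c2 (R, M) t s" "Q s"
    using assms(2) unfolding wp_def by blast
  show ?thesis by (rule wp_intro[OF exec.IfFalse[OF assms(1) h(2)]]) (use h in auto)
qed

definition write_list :: "(int \<Rightarrow> int) \<Rightarrow> int \<Rightarrow> nat list \<Rightarrow> int \<Rightarrow> int" where
  "write_list M g ns y =
     (if g \<le> y \<and> y < g + int (length ns) then int (ns ! nat (y - g)) else M y)"

lemma write_list_Nil: "write_list M g [] = M"
  by (auto simp: write_list_def)

lemma write_list_append:
  "(write_list M g ns)(g + int (length ns) := int x) = write_list M g (ns @ [x])"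
  by (auto simp: write_list_def fun_eq_iff nth_append)

lemma write_list_nth: "i < length ns \<Longrightarrow> write_list M g ns (g + int i) = int (ns ! i)"
  by (simp add: write_list_def)

lemma write_list_outside: "y < g \<or> g + int (length ns) \<le> y \<Longrightarrow> write_list M g ns y = M y"
  by (auto simp: write_list_def)

section \<open>The reduction as a program\<close>

text \<open>Registers below N are left to the matching algorithm; \<open>N, N+1\<close> hold a and b, \<open>N+2\<close> the
  constant 1, \<open>N+3..N+8\<close> the multiples \<open>S..6S\<close> of \<open>S = (b+1)^2\<close>, \<open>N+9\<close> the product ab,
  \<open>N+10\<close> the number of proper tokens, \<open>N+11\<close> the number of dummies, \<open>N+12\<close> the size n of the
  instance and \<open>N+13\<close> the loop counter.\<close>

definition load_constants :: "nat \<Rightarrow> com" where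
  "load_constants N =
     Const (N+17) 0 ;;
     Const (N+2) 1 ;;
     Op Add N 0 (N+17) ;;
     Op Add (N+1) 1 (N+17) ;;
     Op Add (N+14) (N+1) (N+2) ;;
     Op Mul (N+3) (N+14) (N+14) ;;
     Op Add (N+4) (N+3) (N+3) ;;
     Op Add (N+5) (N+4) (N+3) ;;
     Op Add (N+6) (N+5) (N+3) ;;
     Op Add (N+7) (N+6) (N+3) ;;
     Op Add (N+8) (N+7) (N+3) ;;
     Op Mul (N+9) N (N+1) ;;
     Op Mod (N+11) (N+1) N ;;
     Op Sub (N+10) (N+1) (N+11)"

text \<open>The memory is divided into blocks of length \<open>S\<close>: the input matrix from 0,
  column flags from \<open>S\<close>, row flags from \<open>2S\<close>, the list of columns from
  \<open>3S\<close>, the list of rows from \<open>4S\<close> and the new matrix from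
  \<open>5S\<close>. A zero at row i and column j means that the two points coincide, so both
  indices are flagged.\<close>

definition flag_zeros :: "nat \<Rightarrow> com" where
  "flag_zeros N =
     Const (N+13) 0 ;;
     WhileLess (N+13) (N+9) (
       Load (N+14) (N+13) ;;
       IfLess (N+14) (N+2) (
         Op Mod (N+15) (N+13) (N+1) ;;
         Op Add (N+15) (N+15) (N+3) ;;
         Store (N+15) (N+2) ;;
         Op Div (N+15) (N+13) (N+1) ;;
         Op Add (N+15) (N+15) (N+4) ;;
         Store (N+15) (N+2)) Skip ;;
       Op Add (N+13) (N+13) (N+2))"

text \<open>All \<open>b\<close> positions are scanned for rows as well as for columns. Row flags
  occur only below \<open>a\<close>, so further copies and dummies are kept automatically. The
  counter left by the last call is the size of the instance.\<close>

definition collect_unflagged :: "nat \<Rightarrow> nat \<Rightarrow> nat \<Rightarrow> com" where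
  "collect_unflagged N f g =
     Const (N+12) 0 ;;
     Const (N+13) 0 ;;
     WhileLess (N+13) (N+1) (
       Op Add (N+14) (N+13) f ;;
       Load (N+14) (N+14) ;;
       IfLess (N+14) (N+2) (
         Op Add (N+15) (N+12) g ;;
         Store (N+15) (N+13) ;;
         Op Add (N+12) (N+12) (N+2)) Skip ;;
       Op Add (N+13) (N+13) (N+2))"

definition write_cells :: "nat \<Rightarrow> com" where
  "write_cells N =
     Op Mul (N+16) (N+12) (N+12) ;;
     Const (N+13) 0 ;;
     WhileLess (N+13) (N+16) (
       Op Div (N+14) (N+13) (N+12) ;;
       Op Add (N+14) (N+14) (N+6) ;;
       Load (N+14) (N+14) ;;
       Op Add (N+15) (N+13) (N+7) ;;
       IfLess (N+14) (N+10) (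
         Op Mod (N+14) (N+14) N ;;
         Op Mul (N+14) (N+14) (N+1) ;;
         Op Mod (N+17) (N+13) (N+12) ;;
         Op Add (N+17) (N+17) (N+5) ;;
         Load (N+17) (N+17) ;;
         Op Add (N+14) (N+14) (N+17) ;;
         Load (N+14) (N+14) ;;
         Store (N+15) (N+14)) (Store (N+15) (N+2)) ;;
       Op Add (N+13) (N+13) (N+2))"

text \<open>Moving everything down by \<open>5S\<close> also clears the scratch memory.\<close>

definition shift_down :: "nat \<Rightarrow> com" where
  "shift_down N =
     Const (N+13) 0 ;;
     WhileLess (N+13) (N+8) (
       Op Add (N+14) (N+13) (N+7) ;;
       Load (N+14) (N+14) ;;
       Store (N+13) (N+14) ;;
       Op Add (N+13) (N+13) (N+2))"

definition build_instance :: "nat \<Rightarrow> com" where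
  "build_instance N =
     load_constants N ;;
     flag_zeros N ;;
     collect_unflagged N (N+3) (N+5) ;;
     collect_unflagged N (N+4) (N+6) ;;
     write_cells N ;;
     shift_down N"

section \<open>Correctness of the passes over the memory\<close>

locale reduction =
  fixes N a b :: nat and W :: int and M0 :: "int \<Rightarrow> int"
  assumes N: "2 \<le> N"
    and a: "0 < a" and ab: "a \<le> b"
    and W: "11 * (int b + 1)\<^sup>2 \<le> W"
    and M0_nonneg: "\<And>y. 0 \<le> M0 y"
    and M0_outside: "\<And>y. y < 0 \<or> int (a * b) \<le> y \<Longrightarrow> M0 y = 0"
begin

text \<open>Each block has room for a matrix with at most \<open>b * b\<close> entries. The bound
  \<open>11 * S \<le> W\<close> comes from the final shift, whose counter runs up to
  \<open>6S\<close> and reads \<open>5S\<close> above itself.\<close>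

definition S :: int where "S = (int b + 1)\<^sup>2"

lemma S_bounds: "int (a * b) < S" "2 * int b < S" "int (b * b) < S" "int b < S" "0 < S" "11 * S \<le> W"
proof -
  have "a * b \<le> b * b" using ab by simp
  then have "int (a * b) \<le> int (b * b)" by (simp only: of_nat_le_iff)
  moreover have "S = int (b * b) + 2 * int b + 1" by (simp add: S_def power2_eq_square algebra_simps)
  ultimately show "int (a * b) < S" "2 * int b < S" "int (b * b) < S" "int b < S" "0 < S" "11 * S \<le> W"
    using W by (simp_all add: S_def)
qed

text \<open>The last clause keeps the low registers as the matching program expects to find them.
  Registers 0 and 1 are exempt, since they receive the new size just before the call.\<close>

definition fixed :: "(nat \<Rightarrow> int) \<Rightarrow> bool" where
  "fixed R \<longleftrightarrow> R N = int a \<and> R (N+1) = int b \<and> R (N+2) = 1 \<and> R (N+3) = S \<and> R (N+4) = 2 * S \<and>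
     R (N+5) = 3 * S \<and> R (N+6) = 4 * S \<and> R (N+7) = 5 * S \<and> R (N+8) = 6 * S \<and>
     R (N+9) = int (a * b) \<and> R (N+10) = int (b div a * a) \<and> R (N+11) = int (b mod a) \<and>
     (\<forall>i<N. 2 \<le> i \<longrightarrow> R i = 0)"

lemma fixed_upd [simp]: "N + 12 \<le> i \<Longrightarrow> fixed (R(i := v)) \<longleftrightarrow> fixed R"
  by (auto simp: fixed_def)

lemma fixedD:
  assumes "fixed R"
  shows "R N = int a" "R (N+1) = int b" "R (Suc N) = int b" "R (N+2) = 1" "R (N+3) = S" "R (N+4) = 2 * S"
    "R (Suc (Suc N)) = 1" "R (N+5) = 3 * S" "R (N+6) = 4 * S" "R (N+7) = 5 * S" "R (N+8) = 6 * S"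
    "R (N+9) = int (a * b)" "R (N+10) = int (b div a * a)" "R (N+11) = int (b mod a)"
  using assms by (simp_all add: fixed_def)

lemma load_constants_correct:
  assumes "R 0 = int a" "R 1 = int b" "\<And>i. 2 \<le> i \<Longrightarrow> R i = 0"
  shows "wp W (load_constants N) 14 (\<lambda>s. fixed (fst s) \<and> snd s = M) (R, M)"
proof -
  have ne: "N \<noteq> 0" "N \<noteq> Suc 0" "0 \<noteq> N" "Suc 0 \<noteq> N" using N by auto
  have R1: "R (Suc 0) = int b" using assms(2) by simp
  have bS: "int a * int b < S" "int b * int b < S" using S_bounds by simp_all
  have sq: "(int b + 1) * (int b + 1) = S" by (simp add: S_def power2_eq_square)
  have K: "int b - int b mod int a = int (b div a) * int a"
    by (simp add: minus_mod_eq_div_mult zdiv_int)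
  have "b div a * a \<le> b" by (rule div_times_less_eq_dividend)
  then have le: "int (b div a) * int a \<le> int b" by (simp flip: of_nat_mult)
  have md: "int b mod int a = int (b mod a)" by (simp add: zmod_int)
  have "b mod a \<le> b" by (rule mod_less_eq_dividend)
  then have mW: "int (b mod a) \<le> W" using S_bounds(4-6) by linarith
  show ?thesis
    unfolding load_constants_def
    apply (rule wp_steps_le)
     apply (rule wp_Seq_steps wp_Const | rule wp_Op, simp add: ne R1 assms, simp add: ne R1 assms)+
    using S_bounds ab le mW
    apply (simp_all add: ne R1 assms K[unfolded md] fixed_def sq md)
    done
qed

text \<open>The guard \<open>i < a\<close> matters: \<open>i\<close> ranges up to \<open>b\<close>,
  and beyond the matrix the memory is 0, which would pass for distance 0.\<close>

definition zero_row :: "nat \<Rightarrow> bool" where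
  "zero_row i \<longleftrightarrow> i < a \<and> (\<exists>j<b. M0 (int (i * b + j)) < 1)"

definition zero_col :: "nat \<Rightarrow> bool" where
  "zero_col j \<longleftrightarrow> (\<exists>i<a. M0 (int (i * b + j)) < 1)"

definition flags :: "nat \<Rightarrow> int set" where
  "flags m = (\<Union>e\<in>{e. e < m \<and> M0 (int e) < 1}. {S + int (e mod b), 2 * S + int (e div b)})"

definition flagged :: "nat \<Rightarrow> int \<Rightarrow> int" where
  "flagged m y = (if y \<in> flags m then 1 else M0 y)"

lemma flags_range:
  assumes "y \<in> flags m" "m \<le> a * b"
  shows "S \<le> y" "y < 3 * S"
proof -
  obtain e where e: "e < m" "y = S + int (e mod b) \<or> y = 2 * S + int (e div b)"
    using assms by (auto simp: flags_def)
  have "e mod b < b" "e div b < b"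
    using e(1) assms(2) a ab div_less_iff_less_mult[of b e a] by auto
  then have "int (e mod b) < S" "int (e div b) < S" using S_bounds(4) by linarith+
  then show "S \<le> y" "y < 3 * S" using e(2) S_bounds(5) by auto
qed

lemma flagged_low: "m \<le> a * b \<Longrightarrow> y < S \<Longrightarrow> flagged m y = M0 y"
  using flags_range by (force simp: flagged_def)

lemma flagged_high: "m \<le> a * b \<Longrightarrow> 3 * S \<le> y \<Longrightarrow> flagged m y = 0"
  using flags_range S_bounds by (force simp: flagged_def intro: M0_outside)

lemma flagged_Suc:
  "flagged (Suc m) = (if M0 (int m) < 1
     then (flagged m)(S + int (m mod b) := 1, 2 * S + int (m div b) := 1) else flagged m)"
  by (auto simp: flagged_def flags_def fun_eq_iff less_Suc_eq)

lemma flags_iff: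
  "y \<in> flags (a * b) \<longleftrightarrow>
    (\<exists>i<a. \<exists>j<b. M0 (int (i * b + j)) < 1 \<and> (y = S + int j \<or> y = 2 * S + int i))"
proof
  assume "y \<in> flags (a * b)"
  then obtain e where e: "e < a * b" "M0 (int e) < 1" "y = S + int (e mod b) \<or> y = 2 * S + int (e div b)"
    by (auto simp: flags_def)
  have "e div b < a" "e mod b < b" using e(1) a ab by (simp_all add: div_less_iff_less_mult)
  then show "\<exists>i<a. \<exists>j<b. M0 (int (i * b + j)) < 1 \<and> (y = S + int j \<or> y = 2 * S + int i)"
    using e(2,3) by (intro exI[of _ "e div b"] conjI exI[of _ "e mod b"]) auto
next
  assume "\<exists>i<a. \<exists>j<b. M0 (int (i * b + j)) < 1 \<and> (y = S + int j \<or> y = 2 * S + int i)"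
  then obtain i j where ij: "i < a" "j < b" "M0 (int (i * b + j)) < 1" "y = S + int j \<or> y = 2 * S + int i"
    by blast
  have "Suc i * b \<le> a * b" using ij(1) by (intro mult_right_mono) auto
  then have "i * b + j < a * b" using ij(2) by simp
  moreover have "(i * b + j) mod b = j" "(i * b + j) div b = i" using ij(2) by simp_all
  ultimately show "y \<in> flags (a * b)"
    using ij(3,4) unfolding flags_def by (intro UN_I[of "i * b + j"]) auto
qed

lemma flagged_col: "j < b \<Longrightarrow> flagged (a * b) (S + int j) = (if zero_col j then 1 else 0)"
  unfolding flagged_def flags_iff zero_col_def
  using S_bounds(1,4) by (auto intro: M0_outside)

lemma flagged_row: "i < b \<Longrightarrow> flagged (a * b) (2 * S + int i) = (if zero_row i then 1 else 0)"
  unfolding flagged_def flags_iff zero_row_def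
  using S_bounds(1,4,5) by (auto intro: M0_outside)

lemma flag_zeros_body:
  assumes m: "m < a * b" and R: "fixed R" "R (N+13) = int m"
  shows "wp W (Load (N+14) (N+13) ;;
       IfLess (N+14) (N+2) (
         Op Mod (N+15) (N+13) (N+1) ;;
         Op Add (N+15) (N+15) (N+3) ;;
         Store (N+15) (N+2) ;;
         Op Div (N+15) (N+13) (N+1) ;;
         Op Add (N+15) (N+15) (N+4) ;;
         Store (N+15) (N+2)) Skip ;;
       Op Add (N+13) (N+13) (N+2)) 10
    (\<lambda>s. fixed (fst s) \<and> fst s (N+13) = int (Suc m) \<and> snd s = flagged (Suc m)) (R, flagged m)"
proof -
  have "m mod b < b" "m div b < b"
    using m a ab div_less_iff_less_mult[of b m a] by auto
  then have "int (m mod b) < S" "int (m div b) < S" "int m < S"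
    using S_bounds(1,4) m by linarith+
  then have bd: "int m mod int b < S" "int m div int b < S" "int m < S"
    by (simp_all add: zmod_int zdiv_int)
  have nn: "0 \<le> int m mod int b" "0 \<le> int m div int b"
    using a ab by (simp_all add: pos_imp_zdiv_nonneg_iff)
  have low: "flagged m (int m) = M0 (int m)" using bd m by (intro flagged_low) auto
  note simps = R low fixedD[OF R(1)]
  show ?thesis
  proof (cases "M0 (int m) < 1")
    case True
    show ?thesis
      apply (rule wp_steps_le)
      apply (rule wp_Seq_steps wp_Skip | rule wp_Op wp_Store wp_Load, simp add: simps, simp add: simps
        | rule wp_IfLess_true, simp add: simps True )+
      using bd nn S_bounds(5,6)
      apply (simp_all add: simps flagged_Suc True zmod_int zdiv_int add.commute)
      done
  next
    case False
    show ?thesis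
      apply (rule wp_steps_le)
      apply (rule wp_Seq_steps wp_Skip | rule wp_Op wp_Store wp_Load, simp add: simps, simp add: simps
        | rule wp_IfLess_false, simp add: simps False)+
      using bd nn S_bounds(5,6)
      apply (simp_all add: simps flagged_Suc False)
      done
  qed
qed

lemma flag_zeros_correct:
  assumes "fixed R"
  shows "wp W (flag_zeros N) (a * b * (10 + 1) + 2)
    (\<lambda>s. fixed (fst s) \<and> snd s = flagged (a * b)) (R, M0)"
  unfolding flag_zeros_def
  apply (rule wp_For[where n = "a * b" and
        I = "\<lambda>m R M. fixed R \<and> R (N+13) = int m \<and> M = flagged m"])
  subgoal using flag_zeros_body by auto
  subgoal by (metis fixedD(12) of_nat_less_iff)
  subgoal using assms by (auto simp: flagged_def flags_def)
  subgoal by simp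
  subgoal using S_bounds by simp
  done

definition unflagged :: "(nat \<Rightarrow> bool) \<Rightarrow> nat \<Rightarrow> nat list" where
  "unflagged P m = filter (\<lambda>j. \<not> P j) [0..<m]"

text \<open>The condition \<open>F + int b \<le> G\<close> places the list being written above all
  flags, so no flag is overwritten before it is read.\<close>

lemma collect_body:
  fixes P :: "nat \<Rightarrow> bool"
  assumes m: "m < b" and R: "fixed R" "R (N+13) = int m" "R (N+12) = int (length (unflagged P m))"
    and fg: "f < N + 12" "g < N + 12" "R f = F" "R g = G"
    and FG: "0 \<le> F" "F + int b \<le> G" "G + int b \<le> 11 * S"
    and M: "\<And>j. j < b \<Longrightarrow> M (F + int j) = (if P j then 1 else 0)"
  shows "wp W (Op Add (N+14) (N+13) f ;;
       Load (N+14) (N+14) ;;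
       IfLess (N+14) (N+2) (
         Op Add (N+15) (N+12) g ;;
         Store (N+15) (N+13) ;;
         Op Add (N+12) (N+12) (N+2)) Skip ;;
       Op Add (N+13) (N+13) (N+2)) 8
    (\<lambda>s. fixed (fst s) \<and> fst s (N+13) = int (Suc m) \<and> fst s (N+12) = int (length (unflagged P (Suc m))) \<and>
      snd s = write_list M G (unflagged P (Suc m))) (R, write_list M G (unflagged P m))"
proof -
  have len: "length (unflagged P m) \<le> m" unfolding unflagged_def using length_filter_le[of _ "[0..<m]"] by simp
  have read: "write_list M G (unflagged P m) (F + int m) = (if P m then 1 else 0)"
    using FG m M[OF m] by (subst write_list_outside) auto
  have bd: "int (length (unflagged P m)) < S" "int m < S" "F + int m < 11 * S" "G + int (length (unflagged P m)) < 11 * S"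
    "0 \<le> G"
    using len m FG S_bounds(4) by linarith+
  have ne: "f \<noteq> N + 14" "f \<noteq> N + 13" "f \<noteq> N + 12" "g \<noteq> N + 14" "g \<noteq> N + 13" "g \<noteq> N + 12"
    using fg by auto
  note simps = R fg ne read fixedD[OF R(1)] add.commute[of _ F] add.commute[of _ G]
  show ?thesis
  proof (cases "P m")
    case False
    then have l: "unflagged P (Suc m) = unflagged P m @ [m]" by (simp add: unflagged_def)
    show ?thesis
      apply (rule wp_steps_le)
      apply (rule wp_Seq_steps wp_Skip | rule wp_Op wp_Store wp_Load, simp add: simps, simp add: simps
        | rule wp_IfLess_true, simp add: simps False)+
      using bd FG(1) S_bounds(5,6)
      apply (simp_all add: simps l write_list_append)
      done
  next
    case True
    then have l: "unflagged P (Suc m) = unflagged P m" by (simp add: unflagged_def)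
    show ?thesis
      apply (rule wp_steps_le)
      apply (rule wp_Seq_steps wp_Skip | rule wp_Op wp_Store wp_Load, simp add: simps, simp add: simps
        | rule wp_IfLess_false, simp add: simps True)+
      using bd FG(1) S_bounds(5,6)
      apply (simp_all add: simps l)
      done
  qed
qed

lemma collect_correct:
  fixes P :: "nat \<Rightarrow> bool"
  assumes R: "fixed R" and fg: "f < N + 12" "g < N + 12" "\<And>R. fixed R \<Longrightarrow> R f = F" "\<And>R. fixed R \<Longrightarrow> R g = G"
    and FG: "0 \<le> F" "F + int b \<le> G" "G + int b \<le> 11 * S"
    and M: "\<And>j. j < b \<Longrightarrow> M (F + int j) = (if P j then 1 else 0)"
  shows "wp W (collect_unflagged N f g) (1 + (b * (8 + 1) + 2))
    (\<lambda>s. fixed (fst s) \<and> fst s (N+12) = int (length (unflagged P b)) \<and> snd s = write_list M G (unflagged P b)) (R, M)"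
  unfolding collect_unflagged_def
  apply (rule wp_Seq)
  apply (rule wp_intro[OF exec.Const])
  subgoal using S_bounds by simp
  subgoal by simp
  apply (rule wp_For[where n = b and I = "\<lambda>m R M'. fixed R \<and> R (N+13) = int m \<and>
      R (N+12) = int (length (unflagged P m)) \<and> M' = write_list M G (unflagged P m)"])
  subgoal for j R' M'
    using collect_body[of j R' P f g F G M] fg(1,2) fg(3,4)[of R'] FG M by blast
  subgoal by (metis fixedD(2) of_nat_less_iff)
  subgoal using R by (simp add: unflagged_def write_list_Nil)
  subgoal by simp
  subgoal using S_bounds by simp
  done

definition rows :: "nat list" where "rows = unflagged zero_row b"
definition cols :: "nat list" where "cols = unflagged zero_col b"

abbreviation "n \<equiv> length rows"

definition cell :: "nat \<Rightarrow> nat" where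
  "cell e = (if rows ! (e div n) < b div a * a
     then nat (M0 (int (rows ! (e div n) mod a * b + cols ! (e mod n)))) else 1)"

definition mem3 :: "int \<Rightarrow> int" where
  "mem3 = write_list (write_list (flagged (a * b)) (3 * S) cols) (4 * S) rows"

definition mem4 :: "nat \<Rightarrow> int \<Rightarrow> int" where
  "mem4 e = write_list mem3 (5 * S) (map cell [0..<e])"

lemma rows_lt: "i < n \<Longrightarrow> rows ! i < b"
  using nth_mem[of i rows] by (auto simp: rows_def unflagged_def)

lemma cols_lt: "i < length cols \<Longrightarrow> cols ! i < b"
  using nth_mem[of i cols] by (auto simp: cols_def unflagged_def)

lemma n_le: "n \<le> b"
  using length_filter_le[of _ "[0..<b]"] by (simp add: rows_def unflagged_def)

text \<open>For an arbitrary matrix the two lists can differ in length, for instance if one row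
  contains two zeros. Equality holds because the zeros encode equality of points, and it is supplied
  from \<open>length_rows_cols\<close>.\<close>

context
  assumes eq_length: "length cols = n"
begin

lemma mem4_rows: "i < n \<Longrightarrow> mem4 e (4 * S + int i) = int (rows ! i)"
  using n_le S_bounds(4) by (simp add: mem4_def mem3_def write_list_outside write_list_nth)

lemma mem4_cols: "i < n \<Longrightarrow> mem4 e (3 * S + int i) = int (cols ! i)"
  using n_le S_bounds(4) eq_length by (simp add: mem4_def mem3_def write_list_outside write_list_nth)

lemma mem4_low: "y < S \<Longrightarrow> mem4 e y = M0 y"
  using S_bounds(5) by (simp add: mem4_def mem3_def write_list_outside flagged_low)

lemma mem4_cells: "e < m \<Longrightarrow> mem4 m (5 * S + int e) = int (cell e)"
  using write_list_nth[of e "map cell [0..<m]"] by (simp add: mem4_def)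

lemma mem4_high: "5 * S + int e \<le> y \<Longrightarrow> mem4 e y = 0"
  using S_bounds(4,5) n_le eq_length by (simp add: mem4_def mem3_def write_list_outside flagged_high)

lemma mem4_neg: "y < 0 \<Longrightarrow> mem4 e y = 0"
  using S_bounds(5) by (simp add: mem4_low M0_outside)

lemma mem4_Suc: "mem4 (Suc e) = (mem4 e)(5 * S + int e := int (cell e))"
  using write_list_append[of mem3 "5 * S" "map cell [0..<e]"] by (simp add: mem4_def)

lemma nn_less: "int (n * n) < S"
proof -
  have "n * n \<le> b * b" using n_le by (intro mult_mono) auto
  then show ?thesis using S_bounds(3) by linarith
qed

lemma write_cells_body:
  assumes e: "e < n * n" and R: "fixed R" "R (N+13) = int e" "R (N+12) = int n" "R (N+16) = int (n * n)"
  shows "wp W (Op Div (N+14) (N+13) (N+12) ;;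
       Op Add (N+14) (N+14) (N+6) ;;
       Load (N+14) (N+14) ;;
       Op Add (N+15) (N+13) (N+7) ;;
       IfLess (N+14) (N+10) (
         Op Mod (N+14) (N+14) N ;;
         Op Mul (N+14) (N+14) (N+1) ;;
         Op Mod (N+17) (N+13) (N+12) ;;
         Op Add (N+17) (N+17) (N+5) ;;
         Load (N+17) (N+17) ;;
         Op Add (N+14) (N+14) (N+17) ;;
         Load (N+14) (N+14) ;;
         Store (N+15) (N+14)) (Store (N+15) (N+2)) ;;
       Op Add (N+13) (N+13) (N+2)) 15
    (\<lambda>s. fixed (fst s) \<and> fst s (N+13) = int (Suc e) \<and> fst s (N+12) = int n \<and>
      fst s (N+16) = int (n * n) \<and> snd s = mem4 (Suc e)) (R, mem4 e)"
proof -
  let ?t = "rows ! (e div n)" and ?q = "cols ! (e mod n)"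
  have "0 < n" using e by (cases n) auto
  then have dm: "e div n < n" "e mod n < n"
    using e by (simp_all add: div_less_iff_less_mult)
  have t: "?t < b" using rows_lt dm by simp
  have q: "?q < b" using cols_lt dm eq_length by simp
  have "?t mod a * b + ?q < a * b"
  proof -
    have "Suc (?t mod a) * b \<le> a * b" using a by (intro mult_right_mono) (auto simp: Suc_le_eq)
    then show ?thesis using q by simp
  qed
  then have adr: "int (?t mod a * b + ?q) < S" "int (?t mod a * b) < S"
    using S_bounds(1) by linarith+
  have bd: "int (e div n) < S" "int (e mod n) < S" "int e < S" "int (?t mod a) < S"
    using dm n_le S_bounds(4) t e nn_less mod_less_eq_dividend[of ?t a] by linarith+
  have eqs: "int e div int n = int (e div n)" "int e mod int n = int (e mod n)"
    "int ?t mod int a = int (?t mod a)" by (simp_all add: zmod_int zdiv_int)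
  have tab: "int (?t mod a) * int b = int (?t mod a * b)"
    "int (?t mod a * b) + int ?q = int (?t mod a * b + ?q)" by simp_all
  have read: "mem4 e (int (?t mod a * b + ?q)) = M0 (int (?t mod a * b + ?q))"
    using adr by (intro mem4_low) auto
  note simps = R fixedD[OF R(1)] eqs tab read mem4_rows[OF dm(1)] mem4_cols[OF dm(2)]
    add.commute[of _ "_ * S"]
  show ?thesis
  proof (cases "?t < b div a * a")
    case True
    then have c: "int (cell e) = M0 (int (?t mod a * b + ?q))"
      using M0_nonneg by (simp add: cell_def)
    show ?thesis
      apply (rule wp_steps_le)
      apply (rule wp_Seq_steps wp_Skip | rule wp_Op wp_Store wp_Load, simp add: simps del: of_nat_mult of_nat_add, simp add: simps del: of_nat_mult of_nat_add
        | rule wp_IfLess_true, simp add: simps True del: of_nat_mult of_nat_add)+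
      using bd adr S_bounds(5,6)
      apply (simp_all add: simps mem4_Suc c  del: of_nat_mult of_nat_add)
      done
  next
    case False
    then have c: "cell e = 1" by (simp add: cell_def)
    show ?thesis
      apply (rule wp_steps_le)
      apply (rule wp_Seq_steps wp_Skip | rule wp_Op wp_Store wp_Load, simp add: simps del: of_nat_mult of_nat_add, simp add: simps del: of_nat_mult of_nat_add
        | rule wp_IfLess_false, simp add: simps False del: of_nat_mult of_nat_add)+
      using bd adr S_bounds(5,6)
      apply (simp_all add: simps mem4_Suc c del: of_nat_mult of_nat_add)
      done
  qed
qed

lemma write_cells_correct:
  assumes "fixed R" "R (N+12) = int n"
  shows "wp W (write_cells N) (1 + (n * n * (15 + 1) + 2))
    (\<lambda>s. fixed (fst s) \<and> fst s (N+12) = int n \<and> snd s = mem4 (n * n)) (R, mem3)"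
  unfolding write_cells_def
  apply (rule wp_Seq)
  apply (rule wp_intro[OF exec.Op])
  subgoal using assms nn_less S_bounds(5,6) by simp
  subgoal by simp
  apply (rule wp_For[where n = "n * n" and I = "\<lambda>m R M. fixed R \<and> R (N+13) = int m \<and>
      R (N+12) = int n \<and> R (N+16) = int (n * n) \<and> M = mem4 m"])
  subgoal using write_cells_body by auto
  subgoal by (metis of_nat_less_iff)
  subgoal using assms by (simp add: mem4_def write_list_Nil)
  subgoal by simp
  subgoal using S_bounds by simp
  done

definition shifted :: "nat \<Rightarrow> int \<Rightarrow> int" where
  "shifted e y = (if 0 \<le> y \<and> y < int e then mem4 (n * n) (5 * S + y) else mem4 (n * n) y)"

lemma shifted_Suc: "shifted (Suc e) = (shifted e)(int e := mem4 (n * n) (5 * S + int e))"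
  by (auto simp: shifted_def fun_eq_iff)

lemma shift_down_body:
  assumes e: "int e < 6 * S" and R: "fixed R" "R (N+13) = int e" "R (N+12) = int n"
  shows "wp W (Op Add (N+14) (N+13) (N+7) ;;
       Load (N+14) (N+14) ;;
       Store (N+13) (N+14) ;;
       Op Add (N+13) (N+13) (N+2)) 4
    (\<lambda>s. fixed (fst s) \<and> fst s (N+13) = int (Suc e) \<and> fst s (N+12) = int n \<and>
      snd s = shifted (Suc e)) (R, shifted e)"
proof -
  \<comment> \<open>Moving in place is safe: only cells below \<open>e\<close> have been
    overwritten, and the source lies \<open>5S\<close> above \<open>e\<close>.\<close>
  have read: "shifted e (5 * S + int e) = mem4 (n * n) (5 * S + int e)"
    using S_bounds(5) by (simp add: shifted_def)
  note simps = R fixedD[OF R(1)] read add.commute[of _ "_ * S"]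
  show ?thesis
    apply (rule wp_steps_le)
    apply (rule wp_Seq_steps wp_Skip | rule wp_Op wp_Store wp_Load, simp add: simps, simp add: simps)+
    using e S_bounds(5,6)
    apply (simp_all add: simps shifted_Suc)
    done
qed

text \<open>Above the new matrix there are only zeros, so shifting \<open>6S\<close> cells rather
  than \<open>n * n\<close> pulls zeros over the input, the flags, the lists and the old copy of the
  matrix.\<close>

lemma shifted_final:
  assumes "int m = 6 * S"
  shows "shifted m y = (if 0 \<le> y \<and> y < int (n * n) then int (cell (nat y)) else 0)"
proof -
  consider "y < 0" | "0 \<le> y" "y < int (n * n)" | "int (n * n) \<le> y" "y < 6 * S" | "6 * S \<le> y"
    by linarith
  then show ?thesis
  proof cases
    case 1
    then show ?thesis by (simp add: shifted_def mem4_neg)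
  next
    case 2
    then obtain e where e: "y = int e" "e < n * n" by (metis zero_le_imp_eq_int of_nat_less_iff)
    have "y < 6 * S" using 2 nn_less S_bounds(5) by linarith
    then show ?thesis using mem4_cells[OF e(2)] 2 e(1) assms
      by (simp add: shifted_def del: of_nat_mult)
  next
    case 3
    then show ?thesis using mem4_high[of "n * n" "5 * S + y"] mem4_high[of "n * n" y] assms
      by (simp add: shifted_def del: of_nat_mult)
  next
    case 4
    then show ?thesis using mem4_high[of "n * n" y] assms nn_less S_bounds(5)
      by (simp add: shifted_def del: of_nat_mult)
  qed
qed

lemma shift_down_correct:
  assumes "fixed R" "R (N+12) = int n"
  shows "wp W (shift_down N) (nat (6 * S) * (4 + 1) + 2)
    (\<lambda>s. fixed (fst s) \<and> fst s (N+12) = int n \<and>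
      snd s = (\<lambda>y. if 0 \<le> y \<and> y < int (n * n) then int (cell (nat y)) else 0)) (R, mem4 (n * n))"
  unfolding shift_down_def
  apply (rule wp_For[where n = "nat (6 * S)" and I = "\<lambda>m R M. fixed R \<and> R (N+13) = int m \<and>
      R (N+12) = int n \<and> M = shifted m"])
  subgoal using shift_down_body by auto
  subgoal by (auto simp: fixedD(11) nat_less_iff zless_nat_eq_int_zless)
  subgoal using assms by (simp add: shifted_def fun_eq_iff)
  subgoal using shifted_final S_bounds(5) by (simp add: fun_eq_iff)
  subgoal using S_bounds by simp
  done

lemma build_instance_correct:
  assumes "R 0 = int a" "R 1 = int b" "\<And>i. 2 \<le> i \<Longrightarrow> R i = 0"
  shows "wp W (build_instance N) (100 * (b + 1)\<^sup>2)
    (\<lambda>s. fixed (fst s) \<and> fst s (N+12) = int n \<and>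
      snd s = (\<lambda>y. if 0 \<le> y \<and> y < int (n * n) then int (cell (nat y)) else 0)) (R, M0)"
proof -
  have "wp W (build_instance N) (14 + ((a * b * (10 + 1) + 2) + ((1 + (b * (8 + 1) + 2)) +
      ((1 + (b * (8 + 1) + 2)) + ((1 + (n * n * (15 + 1) + 2)) + (nat (6 * S) * (4 + 1) + 2))))))
    (\<lambda>s. fixed (fst s) \<and> fst s (N+12) = int n \<and>
      snd s = (\<lambda>y. if 0 \<le> y \<and> y < int (n * n) then int (cell (nat y)) else 0)) (R, M0)"
    unfolding build_instance_def
    apply (rule wp_Seq)
    apply (rule wp_weaken[OF load_constants_correct[of R M0] order_refl])
       apply (simp_all only: assms)
    subgoal for s1
      apply (cases s1)
      apply (rule wp_Seq)
      apply (simp only: fst_conv snd_conv)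
      apply (rule wp_weaken[OF flag_zeros_correct order_refl], blast)
      subgoal for R1 M1 s2
        apply (cases s2)
        apply (rule wp_Seq)
        apply (simp only: fst_conv snd_conv)
        apply (rule wp_weaken[OF collect_correct[where F = S and G = "3 * S" and P = zero_col] order_refl])
        using S_bounds(4,5) apply (auto simp: fixed_def flagged_col)[9]
        subgoal for R2 M2 s3
          apply (cases s3)
          apply (rule wp_Seq)
          apply (simp only: fst_conv snd_conv)
          apply (rule wp_weaken[OF collect_correct[where F = "2 * S" and G = "4 * S" and P = zero_row] order_refl])
          using S_bounds(4,5) apply (auto simp: fixed_def flagged_row write_list_outside)[9]
          subgoal for R3 M3 s4
            apply (cases s4)
            apply (rule wp_Seq)
            apply (simp only: fst_conv snd_conv flip: rows_def cols_def mem3_def)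
            apply (rule wp_weaken[OF write_cells_correct order_refl], blast, blast)
            subgoal for R4 M4 s5
              apply (cases s5)
              apply (simp only: fst_conv snd_conv)
              apply (rule shift_down_correct, blast, blast)
              done
            done
          done
        done
      done
    done
  \<comment> \<open>The leading terms are \<open>11ab\<close>, \<open>16n^2\<close> and, from the
    shift, 30 times \<open>(b + 1)^2\<close>; the constant 100 leaves ample room.\<close>
  moreover have "14 + ((a * b * (10 + 1) + 2) + ((1 + (b * (8 + 1) + 2)) +
      ((1 + (b * (8 + 1) + 2)) + ((1 + (n * n * (15 + 1) + 2)) + (nat (6 * S) * (4 + 1) + 2))))) \<le> 100 * (b + 1)\<^sup>2"
  proof -
    have "nat (6 * S) = 6 * (b + 1)\<^sup>2"
      by (simp add: S_def nat_mult_distrib nat_power_eq flip: of_nat_Suc)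
    moreover have "a * b \<le> b * b" and "n * n \<le> b * b" using ab n_le by (auto intro: mult_mono)
    moreover have "(b + 1)\<^sup>2 = b * b + 2 * b + 1" by (simp add: power2_eq_square)
    moreover have "14 + ((p * (10 + 1) + 2) + ((1 + (b * (8 + 1) + 2)) +
        ((1 + (b * (8 + 1) + 2)) + ((1 + (q * (15 + 1) + 2)) + (x * (4 + 1) + 2))))) \<le> 100 * s"
      if "x = 6 * s" "p \<le> c" "q \<le> c" "s = c + 2 * b + 1" for p q x s c :: nat
      using that by simp
    ultimately show ?thesis by blast
  qed
  ultimately show ?thesis by (rule wp_weaken)
qed

end

end

text \<open>If the matching program returns \<open>p / q\<close>, the output is
  \<open>(n * p + 2 * r * q) / (b * q)\<close>; the factor 2 arises by adding \<open>r * q\<close>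
  twice. The case \<open>n = 0\<close> is caught first, since MPMCT has no empty instances.\<close>

definition emd_program :: "nat \<Rightarrow> com \<Rightarrow> com" where
  "emd_program N c =
     build_instance N ;;
     IfLess (N+12) (N+2) (Const 0 0 ;; Const 1 1) (
       (Const (N+17) 0 ;; Op Add 0 (N+12) (N+17) ;; Op Add 1 (N+12) (N+17)) ;;
       c ;;
       (Op Mul 0 0 (N+12) ;;
       Op Mul (N+14) (N+11) 1 ;;
       Op Add 0 0 (N+14) ;;
       Op Add 0 0 (N+14) ;;
       Op Mul 1 1 (N+1)))"

context reduction
begin

context
  assumes eq_length: "length cols = n"
begin

lemma wp_If_branch:
  assumes "wp W (if R x < R y then c1 else c2) T Q (R, M)"
  shows "wp W (IfLess x y c1 c2) (T + 1) Q (R, M)"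
proof -
  obtain t s where h: "t \<le> T" "exec W (if R x < R y then c1 else c2) (R, M) t s" "Q s"
    using assms unfolding wp_def by blast
  have "exec W (IfLess x y c1 c2) (R, M) (t + 1) s"
    using h(2) by (cases "R x < R y") (auto intro: exec.IfTrue[simplified] exec.IfFalse[simplified])
  then show ?thesis using h by (intro wp_intro) auto
qed

lemma emd_program_trivial:
  assumes "R 0 = int a" "R 1 = int b" "\<And>i. 2 \<le> i \<Longrightarrow> R i = 0" and "n = 0"
  shows "wp W (emd_program N c) (100 * (b + 1)\<^sup>2 + 3) (\<lambda>s. fst s 0 = 0 \<and> fst s 1 = 1) (R, M0)"
proof -
  have branch: "wp W (IfLess (N+12) (N+2) (Const 0 0 ;; Const 1 1) c2) (2 + 1) (\<lambda>s. fst s 0 = 0 \<and> fst s 1 = 1) s"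
    if s: "fixed (fst s)" "fst s (N+12) = int n" for s c2
  proof -
    obtain R M where RM: "s = (R, M)" by (cases s)
    have lt: "R (N+12) < R (N+2)" using s RM assms(4) by (simp add: fixed_def)
    have W1: "1 \<le> W" using S_bounds(5,6) by linarith
    have "wp W (Const 0 0 ;; Const 1 1) 2 (\<lambda>s. fst s 0 = 0 \<and> fst s 1 = 1) (R, M)"
      apply (rule wp_steps_le)
       apply (rule wp_Seq_steps wp_Const)+
      using W1 by auto
    then show ?thesis unfolding RM using lt by (intro wp_If_branch) simp
  qed
  have "wp W (emd_program N c) (100 * (b + 1)\<^sup>2 + (2 + 1)) (\<lambda>s. fst s 0 = 0 \<and> fst s 1 = 1) (R, M0)"
    unfolding emd_program_def
    by - (rule wp_Seq, rule wp_weaken[OF build_instance_correct[OF eq_length assms(1-3)] order_refl], assumption, rule branch, auto)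
  then show ?thesis by simp
qed

text \<open>The factor 3 in the bound on \<open>B\<close> covers the numerator
  \<open>n * p + 2 * r * q\<close>, as both \<open>n\<close> and \<open>r\<close> are at most
  \<open>b\<close>.\<close>

lemma emd_program_correct:
  assumes R: "R 0 = int a" "R 1 = int b" "\<And>i. 2 \<le> i \<Longrightarrow> R i = 0"
    and n: "n \<noteq> 0" and c: "uses_below N c"
    and run: "exec W c ((\<lambda>_. 0)(0 := int n, 1 := int n),
      \<lambda>y. if 0 \<le> y \<and> y < int (n * n) then int (cell (nat y)) else 0) t (R', M')"
    and B: "\<bar>R' 0\<bar> \<le> B" "\<bar>R' 1\<bar> \<le> B" "3 * int b * B \<le> W"
  shows "wp W (emd_program N c) (100 * (b + 1)\<^sup>2 + t + 20)
    (\<lambda>s. fst s 0 = int n * R' 0 + 2 * int (b mod a) * R' 1 \<and> fst s 1 = int b * R' 1) (R, M0)"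
proof -
  let ?mem = "\<lambda>y. if 0 \<le> y \<and> y < int (n * n) then int (cell (nat y)) else 0"
  let ?Q = "\<lambda>s. fst s 0 = int n * R' 0 + 2 * int (b mod a) * R' 1 \<and> fst s 1 = int b * R' 1"
  let ?pre = "Const (N+17) 0 ;; Op Add 0 (N+12) (N+17) ;; Op Add 1 (N+12) (N+17)"
  let ?post = "Op Mul 0 0 (N+12) ;; Op Mul (N+14) (N+11) 1 ;; Op Add 0 0 (N+14) ;;
    Op Add 0 0 (N+14) ;; Op Mul 1 1 (N+1)"
  have N0: "0 < N" "Suc 0 < N" "N \<noteq> 0" "N \<noteq> Suc 0" "0 \<noteq> N" "Suc 0 \<noteq> N" using N by auto
  define r where "r = b mod a"
  have rb: "r \<le> b" by (simp add: r_def mod_less_eq_dividend)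
  have B0: "0 \<le> B" using B(1) by linarith
  have mul: "\<bar>int x * y\<bar> \<le> int b * B" if "x \<le> b" "\<bar>y\<bar> \<le> B" for x y
    unfolding abs_mult using that by (intro mult_mono) auto
  have bB: "0 \<le> int b * B" using B0 by simp
  have W3: "3 * (int b * B) \<le> W" using B(3) by (simp add: mult.assoc)
  have post: "wp W ?post 5 ?Q (merge N R' Q, M')"
    if Q: "Q (N+12) = int n" "Q (N+11) = int r" "Q (N+1) = int b" for Q
  proof -
    let ?R = "merge N R' Q"
    have R: "?R 0 = R' 0" "?R (Suc 0) = R' 1" "?R (N+12) = int n" "?R (N+11) = int r" "?R (Suc N) = int b"
      using N0 Q by (simp_all add: merge_def)
    have b1: "\<bar>int n * R' 0\<bar> \<le> int b * B" "\<bar>int r * R' 1\<bar> \<le> int b * B" "\<bar>int b * R' 1\<bar> \<le> int b * B"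
      using mul n_le rb B by auto
    have b2: "\<bar>int n * R' 0\<bar> \<le> W" "\<bar>int r * R' 1\<bar> \<le> W" "\<bar>int b * R' 1\<bar> \<le> W"
      "\<bar>int n * R' 0 + int r * R' 1\<bar> \<le> W" "\<bar>int n * R' 0 + 2 * (int r * R' 1)\<bar> \<le> W"
      using b1 bB W3 by linarith+
    note simps = R N0
    show ?thesis
      apply (rule wp_steps_le)
       apply (rule wp_Seq_steps | rule wp_Op, simp add: simps, simp add: simps)+
      using b2 by (simp_all add: simps r_def mult.commute)
  qed
  have branch: "wp W (IfLess (N+12) (N+2) (Const 0 0 ;; Const 1 1) (?pre ;; c ;; ?post)) (3 + (t + 5) + 1) ?Q s"
    if s: "fixed (fst s)" "fst s (N+12) = int n" "snd s = ?mem" for s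
  proof -
    obtain R1 where s1: "s = (R1, ?mem)" using s(3) by (cases s) auto
    have R1: "fixed R1" "R1 (N+12) = int n" using s s1 by auto
    define R2 where "R2 = R1(N+17 := 0, 0 := int n, Suc 0 := int n)"
    have nlt: "\<not> R1 (N+12) < R1 (N+2)" using R1 n by (simp add: fixed_def Suc_le_eq)
    have nW: "int n \<le> W" using n_le S_bounds(4-6) by linarith
    have pre: "wp W ?pre 3 (\<lambda>s. s = (R2, ?mem)) (R1, ?mem)"
      apply (rule wp_steps_le)
       apply (rule wp_Seq_steps wp_Const | rule wp_Op, simp add: R1 N0, simp add: R1 N0)+
      using nW by (auto simp: R2_def)
    \<comment> \<open>Below \<open>N\<close> the registers agree with those of a fresh start, so the
      assumed run of \<open>c\<close> carries over to the actual state.\<close>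
    have "merge N ((\<lambda>_. 0)(0 := int n, 1 := int n)) R2 = R2"
      using R1 N0 by (auto simp: merge_def R2_def fun_eq_iff fixed_def)
    then have ex: "exec W c (R2, ?mem) t (merge N R' R2, M')"
      using exec_frame[OF run c, of R2] by simp
    have "wp W ?post 5 ?Q (merge N R' R2, M')"
      using R1 N0 by (intro post) (simp_all add: R2_def fixed_def r_def)
    then have "wp W c t (wp W ?post 5 ?Q) (R2, ?mem)"
      by (rule wp_intro[OF ex order_refl])
    from wp_Seq[OF this] have "wp W (c ;; ?post) (t + 5) ?Q (R2, ?mem)" .
    then have "wp W (?pre ;; c ;; ?post) (3 + (t + 5)) ?Q (R1, ?mem)"
      by - (rule wp_Seq, rule wp_weaken[OF pre order_refl], simp only:)
    then show ?thesis unfolding s1 using nlt by (intro wp_If_branch) simp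
  qed
  have "wp W (emd_program N c) (100 * (b + 1)\<^sup>2 + (3 + (t + 5) + 1)) ?Q (R, M0)"
    unfolding emd_program_def
    by - (rule wp_Seq, rule wp_weaken[OF build_instance_correct[OF eq_length R] order_refl],
        assumption, rule branch, auto)
  then show ?thesis by (rule wp_weaken) auto
qed

end

end

section \<open>Word size and the guarantee of the combined program\<close>

lemma word_size_bounds:
  fixes a b n k :: nat
  assumes "0 < a" "a \<le> b" "n \<le> b"
  shows "11 * (b + 1)\<^sup>2 \<le> (a + b + 2) ^ (2 * k + 4)"
    and "3 * b * (2 * n + 2) ^ (k + 1) \<le> (a + b + 2) ^ (2 * k + 4)"
proof -
  let ?X = "a + b + 2"
  have X: "b + 3 \<le> ?X" "4 \<le> ?X" using assms by auto
  have X2: "4 * ?X \<le> ?X\<^sup>2" unfolding power2_eq_square using X(2) by (rule mult_right_mono) simp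
  have "11 * (b + 1)\<^sup>2 \<le> ?X\<^sup>2 * ?X\<^sup>2"
  proof (rule mult_mono)
    show "11 \<le> ?X\<^sup>2" by (rule order_trans[OF _ X2]) (use X(2) in simp)
    show "(b + 1)\<^sup>2 \<le> ?X\<^sup>2" using X by (intro power_mono) auto
  qed auto
  also have "\<dots> = ?X ^ 4" by (simp flip: power_add)
  also have "\<dots> \<le> ?X ^ (2 * k + 4)" by (rule power_increasing) auto
  finally show "11 * (b + 1)\<^sup>2 \<le> ?X ^ (2 * k + 4)" .
  \<comment> \<open>If \<open>a < b\<close>, then \<open>2 * n + 2\<close> may exceed the number on
    which the new word bound is based, but not its square. This doubles the exponent, and one more
    square absorbs \<open>3 * b\<close>.\<close>
  have "3 * b * (2 * n + 2) ^ (k + 1) \<le> ?X\<^sup>2 * (?X\<^sup>2) ^ (k + 1)"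
    using X X2 assms(3) by (intro mult_mono power_mono) auto
  also have "\<dots> = ?X ^ (2 * k + 4)" 
  proof -
    have "?X\<^sup>2 * (?X\<^sup>2) ^ (k + 1) = ?X ^ (2 + 2 * (k + 1))"
      by (simp only: power_add power_mult)
    also have "2 + 2 * (k + 1) = 2 * k + 4" by simp
    finally show ?thesis .
  qed
  finally show "3 * b * (2 * n + 2) ^ (k + 1) \<le> ?X ^ (2 * k + 4)" .
qed

context token_matching
begin

lemma input_entry:
  assumes "i < a" "j < b"
  shows "snd (bip_input xs ys d) (int (i * b + j)) = int (d (xs ! i) (ys ! j))"
proof -
  have "Suc i * b \<le> a * b" using assms(1) by (intro mult_right_mono) auto
  then have "i * b + j < a * b" using assms(2) by simp
  moreover have "(i * b + j) mod b = j" "(i * b + j) div b = i"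
    using assms(2) by (cases "b = 0"; simp)+
  ultimately show ?thesis by (simp add: bip_input_def  del: of_nat_add of_nat_mult)
qed

lemma emd_program_estimates:
  fixes \<alpha> \<epsilon> :: real
  assumes alg: "\<And>(A :: nat set) (B :: nat set) w xs ys.
       mpmct_instance A B w \<Longrightarrow> enumerates xs A \<Longrightarrow> enumerates ys B \<Longrightarrow>
       \<exists>\<beta>. outputs_in m c xs ys w (T (card A)) \<beta> \<and> is_estimate \<alpha> \<epsilon> (mpmct_value A B w) \<beta>"
    and N: "2 \<le> N" "uses_below N c" and \<alpha>: "\<alpha> \<ge> 0" and \<epsilon>: "\<epsilon> \<ge> 0"
  shows "\<exists>\<beta>. outputs_in (2 * m + 4) (emd_program N c) xs ys d
      (100 * (b + 1)\<^sup>2 + Max (T ` {..b}) + 20) \<beta> \<and>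
    emd \<le> \<beta> \<and> \<beta> \<le> \<alpha> * emd + \<epsilon> + 2 * real r / real b"
proof -
  define W where "W = int (a + b + 2) ^ (2 * m + 4)"
  define M0 where "M0 = snd (bip_input xs ys d)"
  have W11: "11 * (int b + 1)\<^sup>2 \<le> W"
  proof -
    have "int (11 * (b + 1)\<^sup>2) \<le> int ((a + b + 2) ^ (2 * m + 4))"
      using word_size_bounds(1)[of a b b m] a_pos length by (simp only: of_nat_le_iff)
    then show ?thesis unfolding W_def by (simp add: add.commute)
  qed
  interpret red: reduction N a b W M0
  proof
    show "M0 y = 0" if "y < 0 \<or> int (a * b) \<le> y" for y
      using that unfolding M0_def bip_input_def by auto
    show "0 \<le> M0 y" for y
      unfolding M0_def bip_input_def by simp
  qed (use N a_pos length W11 in auto)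
  have entry: "M0 (int (i * b + j)) = int (d (xs ! i) (ys ! j))" if "i < a" "j < b" for i j
    using input_entry[OF that] by (simp add: M0_def)
  \<comment> \<open>Here the zero test of the program meets the graph: an entry is below 1 exactly
    at a common point, so the unflagged indices are the tokens and columns of the square
    instance.\<close>
  have entry_0: "M0 (int (i * b + j)) < 1 \<longleftrightarrow> xs ! i = ys ! j" if "i < a" "j < b" for i j
    unfolding entry[OF that] using d_eq_0[of "xs ! i" "ys ! j"] that by simp
  have zr: "red.zero_row i \<longleftrightarrow> i \<in> common" for i
    unfolding red.zero_row_def common_def mem_Collect_eq in_set_conv_nth by (metis entry_0)
  have zc: "red.zero_col j \<longleftrightarrow> ys ! j \<in> L" if "j < b" for j
    unfolding red.zero_col_def in_set_conv_nth by (metis entry_0 that)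
  have rows: "List.distinct red.rows" "set red.rows = tokens"
    by (auto simp: red.rows_def red.unflagged_def zr)
  have cols: "List.distinct red.cols" "set red.cols = {j. j < b \<and> ys ! j \<notin> L}"
    by (auto simp: red.cols_def red.unflagged_def zc)
  let ?n = "List.length red.rows"
  let ?w = "w red.rows red.cols"
  have eq: "List.length red.cols = ?n" by (rule length_rows_cols[OF rows cols])
  have nb: "?n \<le> b" by (rule red.n_le)
  have start: "bip_input xs ys d = (fst (bip_input xs ys d), M0)" by (simp add: M0_def)
  have regs: "fst (bip_input xs ys d) 0 = int a" "fst (bip_input xs ys d) 1 = int b"
    "\<And>i. 2 \<le> i \<Longrightarrow> fst (bip_input xs ys d) i = 0"
    by (auto simp: bip_input_def)
  show ?thesis
  proof (cases "?n = 0")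
    case True
    have "wp W (emd_program N c) (100 * (b + 1)\<^sup>2 + 3) (\<lambda>s. fst s 0 = 0 \<and> fst s 1 = 1) (bip_input xs ys d)"
      using red.emd_program_trivial[OF eq regs True, folded start] by simp
    then obtain t2 R2 M2 where "t2 \<le> 100 * (b + 1)\<^sup>2 + 3"
      "exec W (emd_program N c) (bip_input xs ys d) t2 (R2, M2)" "R2 0 = 0" "R2 1 = 1"
      unfolding wp_def by auto
    then have "outputs_in (2 * m + 4) (emd_program N c) xs ys d (100 * (b + 1)\<^sup>2 + Max (T ` {..b}) + 20) 0"
      unfolding outputs_in_def
      by (intro exI[of _ R2] exI[of _ M2] exI[of _ t2]) (auto simp: W_def)
    moreover have "emd = 0" by (rule emd_eq_0[OF rows cols True])
    ultimately show ?thesis using \<epsilon> by (intro exI[of _ 0]) simp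
  next
    case False
    then have inst: "mpmct_instance {..<?n} {..<?n} ?w"
      by (intro mpmct_instance_w[OF rows cols]) simp
    have enum: "enumerates [0..<?n] {..<?n}" by (auto simp: enumerates_def)
    obtain \<beta> where \<beta>: "outputs_in m c [0..<?n] [0..<?n] ?w (T (card {..<?n})) \<beta>"
      "is_estimate \<alpha> \<epsilon> (mpmct_value {..<?n} {..<?n} ?w) \<beta>"
      using alg[OF inst enum enum] by blast
    let ?W1 = "int (?n + ?n + 2) ^ m"
    obtain R' M' t where run: "exec ?W1 c (bip_input [0..<?n] [0..<?n] ?w) t (R', M')"
      "t \<le> T ?n" "R' 1 \<noteq> 0" "\<beta> = of_int (R' 0) / of_int (R' 1)"
      using \<beta>(1) unfolding outputs_in_def by auto
    have mem: "snd (bip_input [0..<?n] [0..<?n] ?w) =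
        (\<lambda>y. if 0 \<le> y \<and> y < int (?n * ?n) then int (red.cell (nat y)) else 0)"
    proof
      fix y
      show "snd (bip_input [0..<?n] [0..<?n] ?w) y =
          (if 0 \<le> y \<and> y < int (?n * ?n) then int (red.cell (nat y)) else 0)"
      proof (cases "0 \<le> y \<and> y < int (?n * ?n)")
        case True
        then obtain e where e: "y = int e" "e < ?n * ?n" by (metis zero_le_imp_eq_int of_nat_less_iff)
        then have pq: "e div ?n < ?n" "e mod ?n < ?n"
          using False by (auto simp: div_less_iff_less_mult)
        have "red.cols ! (e mod ?n) < b" using pq red.cols_lt eq by simp
        moreover have "red.rows ! (e div ?n) mod a < a" using a_pos by simp
        ultimately have "red.cell e = ?w (e div ?n) (e mod ?n)"
          unfolding red.cell_def w_def[OF rows cols] k_def by (simp only: entry nat_int)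
        then show ?thesis using e pq by (simp add: bip_input_def)
      qed (auto simp: bip_input_def)
    qed
    have input: "bip_input [0..<?n] [0..<?n] ?w = ((\<lambda>_. 0)(0 := int ?n, 1 := int ?n),
        \<lambda>y. if 0 \<le> y \<and> y < int (?n * ?n) then int (red.cell (nat y)) else 0)"
      unfolding mem[symmetric] by (simp add: bip_input_def)
    \<comment> \<open>The exponent is \<open>m + 1\<close> rather than \<open>m\<close> because
      \<open>B\<close> must also bound the initial state, that is, the size \<open>?n\<close> and
      weights up to 3; for \<open>m = 0\<close> the word bound is only 1.\<close>
    define B where "B = int (2 * ?n + 2) ^ (m + 1)"
    have W1B: "?W1 \<le> B"
    proof -
      have "?W1 = int (2 * ?n + 2) ^ m" by (simp only: mult_2)
      also have "\<dots> \<le> B" unfolding B_def by (rule power_increasing) auto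
      finally show ?thesis .
    qed
    have nB: "int (2 * ?n + 2) \<le> B"
      unfolding B_def by (rule self_le_power) auto
    have "b > 0" by (rule b_pos)
    have BW: "3 * int b * B \<le> W"
    proof -
      have "int (3 * b * (2 * ?n + 2) ^ (m + 1)) \<le> int ((a + b + 2) ^ (2 * m + 4))"
        using word_size_bounds(2)[of a b ?n m] a_pos length nb by (simp only: of_nat_le_iff)
      then show ?thesis unfolding B_def W_def by (simp only: of_nat_mult of_nat_power of_nat_numeral)
    qed
    have B0: "0 \<le> B" unfolding B_def by simp
    have "1 \<le> 3 * int b" using \<open>b > 0\<close> by linarith
    then have "1 * B \<le> 3 * int b * B" using B0 by (rule mult_right_mono)
    then have "?W1 \<le> W" using W1B BW by linarith
    have wle: "?w p q \<le> 3" if "q < ?n" for p q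
      using w_range[OF rows cols that, of p] by auto
    have bnd: "(\<forall>i. \<bar>R' i\<bar> \<le> B) \<and> (\<forall>i. \<bar>M' i\<bar> \<le> B)"
    proof -
      have "\<bar>fst (bip_input [0..<?n] [0..<?n] ?w) i\<bar> \<le> B" for i
        using nB B0 by (simp add: bip_input_def)
      moreover have "\<bar>snd (bip_input [0..<?n] [0..<?n] ?w) i\<bar> \<le> B" for i
      proof -
        have q: "nat i mod ?n < ?n" using False by simp
        have "int (?w p (nat i mod ?n)) \<le> B" for p
          using wle[OF q, of p] nB False by linarith
        moreover have "nat i div ?n < ?n" if "0 \<le> i" "i < int (?n * ?n)"
          using that False by (simp add: div_less_iff_less_mult nat_less_iff)
        ultimately show ?thesis using B0 q by (simp add: bip_input_def)
      qed
      ultimately show ?thesis using exec_bounded[OF run(1) W1B] by simp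
    qed
    have "exec W c ((\<lambda>_. 0)(0 := int ?n, 1 := int ?n),
        \<lambda>y. if 0 \<le> y \<and> y < int (?n * ?n) then int (red.cell (nat y)) else 0) t (R', M')"
      using exec_mono[OF run(1) \<open>?W1 \<le> W\<close>] unfolding input .
    from red.emd_program_correct[OF eq regs False N(2) this _ _ BW, folded start]
    have "wp W (emd_program N c) (100 * (b + 1)\<^sup>2 + t + 20)
        (\<lambda>s. fst s 0 = int ?n * R' 0 + 2 * int r * R' 1 \<and> fst s 1 = int b * R' 1) (bip_input xs ys d)"
      unfolding r_def using bnd by simp
    then obtain t2 R2 M2 where fin: "t2 \<le> 100 * (b + 1)\<^sup>2 + t + 20"
      "exec W (emd_program N c) (bip_input xs ys d) t2 (R2, M2)"
      "R2 0 = int ?n * R' 0 + 2 * int r * R' 1" "R2 1 = int b * R' 1"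
      unfolding wp_def by auto
    \<comment> \<open>\<open>T\<close> need not be monotone, so \<open>T ?n\<close> is compared with
      the maximum over all sizes up to \<open>b\<close> and not with \<open>T b\<close>.\<close>
    have "t \<le> Max (T ` {..b})"
      using run(2) nb by (intro order_trans[OF _ Max_ge[of _ "T ?n"]]) auto
    then have out: "outputs_in (2 * m + 4) (emd_program N c) xs ys d
        (100 * (b + 1)\<^sup>2 + Max (T ` {..b}) + 20) (of_int (R2 0) / of_int (R2 1))"
      unfolding outputs_in_def using fin run(3) \<open>b > 0\<close>
      by (intro exI[of _ R2] exI[of _ M2] exI[of _ t2]) (auto simp: W_def)
    let ?v = "mpmct_value {..<?n} {..<?n} ?w"
    have val: "of_int (R2 0) / of_int (R2 1) = real ?n / real b * \<beta> + 2 * real r / real b"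
      using run(3) \<open>b > 0\<close> unfolding fin run(4) by (simp add: field_simps)
    have est: "?v \<le> \<beta>" "\<beta> \<le> \<alpha> * ?v + \<epsilon>" using \<beta>(2) by (auto simp: is_estimate_def)
    have bounds: "real ?n / real b * ?v \<le> emd" "emd \<le> real ?n / real b * ?v + 2 * real r / real b"
      using emd_bounds[OF rows cols] False by auto
    have q1: "0 \<le> real ?n / real b" "real ?n / real b \<le> 1" using nb \<open>b > 0\<close> by auto
    have "real ?n / real b * ?v \<le> real ?n / real b * \<beta>" using est(1) q1(1) by (rule mult_left_mono)
    moreover have "real ?n / real b * \<beta> \<le> real ?n / real b * (\<alpha> * ?v + \<epsilon>)"
      using est(2) q1(1) by (rule mult_left_mono)
    moreover have "\<dots> = \<alpha> * (real ?n / real b * ?v) + real ?n / real b * \<epsilon>"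
      by (simp add: algebra_simps)
    moreover have "\<alpha> * (real ?n / real b * ?v) \<le> \<alpha> * emd"
      using bounds(1) \<alpha> by (rule mult_left_mono)
    \<comment> \<open>As \<open>?n \<le> b\<close>, rescaling cannot enlarge the additive error of
      the matching program.\<close>
    moreover have "real ?n / real b * \<epsilon> \<le> 1 * \<epsilon>" using q1(2) \<epsilon> by (rule mult_right_mono)
    ultimately have "emd \<le> of_int (R2 0) / of_int (R2 1)"
      "of_int (R2 0) / of_int (R2 1) \<le> \<alpha> * emd + \<epsilon> + 2 * real r / real b"
      unfolding val using bounds(2) by linarith+
    then show ?thesis using out by blast
  qed
qed

lemma emd_nonneg: "0 \<le> emd"
  by (rule emd_ge) (rule plan_cost_nonneg)

lemma emd_le_3: "emd \<le> 3"
proof -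
  obtain z where z: "plan z" using plan_exists by blast
  then have z': "\<And>x y. x \<in> L \<Longrightarrow> y \<in> R \<Longrightarrow> z x y \<ge> 0" "\<And>x. x \<in> L \<Longrightarrow> (\<Sum>y\<in>R. z x y) = 1 / real a"
    by (auto simp: transport_plan_def)
  have "emd \<le> (\<Sum>x\<in>L. \<Sum>y\<in>R. real (d x y) * z x y)" by (rule emd_le[OF z])
  also have "\<dots> \<le> (\<Sum>x\<in>L. \<Sum>y\<in>R. 3 * z x y)"
    using d_le_3 z'(1) by (intro sum_mono mult_right_mono) auto
  also have "\<dots> = 3"
    using z'(2) card_L a_pos by (simp flip: sum_distrib_left)
  finally show ?thesis .
qed

end

section \<open>The graph of an edge\<close>

lemma gdist_le:
  assumes "(x, y) \<in> {(a, b). {a, b} \<in> E} ^^ n"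
  shows "gdist E x y \<le> n"
  unfolding gdist_def by (rule Least_le) (rule assms)

lemma gdist_walk:
  assumes "(x, y) \<in> {(a, b). {a, b} \<in> E} ^^ n"
  shows "(x, y) \<in> {(a, b). {a, b} \<in> E} ^^ gdist E x y"
  unfolding gdist_def by (rule LeastI) (rule assms)

text \<open>At most one step from x to u, then the edge, then at most one step from v to y. Besides
  the bound 3 this provides the walk without which the \<open>LEAST\<close> in \<open>gdist\<close>
  would be unspecified.\<close>

lemma walk_across_edge:
  assumes "{u, v} \<in> E" "x \<in> closed_nbr E u" "y \<in> closed_nbr E v"
  obtains n where "n \<le> 3" "(x, y) \<in> {(a, b). {a, b} \<in> E} ^^ n"
proof -
  let ?r = "{(a, b). {a, b} \<in> E}"
  have "\<exists>i\<le>1. (x, u) \<in> ?r ^^ i"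
  proof (cases "x = u")
    case True
    then show ?thesis by (intro exI[of _ 0]) simp
  next
    case False
    then show ?thesis using assms(2)
      by (intro exI[of _ 1]) (auto simp: closed_nbr_def nbr_def insert_commute)
  qed
  then obtain i where i: "i \<le> 1" "(x, u) \<in> ?r ^^ i" by blast
  have "\<exists>j\<le>1. (v, y) \<in> ?r ^^ j"
  proof (cases "v = y")
    case True
    then show ?thesis by (intro exI[of _ 0]) simp
  next
    case False
    then show ?thesis using assms(3)
      by (intro exI[of _ 1]) (auto simp: closed_nbr_def nbr_def)
  qed
  then obtain j where j: "j \<le> 1" "(v, y) \<in> ?r ^^ j" by blast
  have "(x, v) \<in> ?r ^^ Suc i" using i(2) assms(1) by (auto intro: relcompI)
  then have "(x, y) \<in> ?r ^^ (Suc i + j)" using j(2) unfolding relpow_add by (rule relcompI)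
  then show ?thesis using that[of "Suc i + j"] i(1) j(1) by simp
qed

lemma length_closed_nbr:
  assumes "simple_graph V E" "enumerates xs (closed_nbr E x)"
  shows "length xs = Suc (deg E x)"
proof -
  have "x \<notin> nbr E x"
  proof
    assume "x \<in> nbr E x"
    then have "card {x, x} = 2" using assms(1) by (simp add: nbr_def simple_graph_def)
    then show False by simp
  qed
  moreover have "nbr E x \<subseteq> V"
    using assms(1) by (auto simp: nbr_def simple_graph_def)
  then have "finite (nbr E x)"
    using assms(1) finite_subset unfolding simple_graph_def by blast
  ultimately have "card (closed_nbr E x) = Suc (deg E x)"
    by (simp add: closed_nbr_def deg_def)
  then show ?thesis
    using assms(2) distinct_card[of xs] by (simp add: enumerates_def)
qed

lemma token_matching_edge:
  assumes G: "simple_graph V E" and uv: "{u, v} \<in> E" and le: "deg E u \<le> deg E v"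
    and xs: "enumerates xs (closed_nbr E u)" and ys: "enumerates ys (closed_nbr E v)"
  shows "token_matching xs ys (gdist E)"
proof
  let ?r = "{(a, b). {a, b} \<in> E}"
  have set: "set xs = closed_nbr E u" "set ys = closed_nbr E v"
    using xs ys by (auto simp: enumerates_def)
  have walk: "\<exists>n\<le>3. (x, y) \<in> ?r ^^ n" if "x \<in> set xs" "y \<in> set ys" for x y
    using walk_across_edge[OF uv, of x y] that set by blast
  show "distinct xs" "distinct ys" using xs ys by (auto simp: enumerates_def)
  show "xs \<noteq> []" "length xs \<le> length ys"
    using length_closed_nbr[OF G xs] length_closed_nbr[OF G ys] le by auto
  show "gdist E x y = 0 \<longleftrightarrow> x = y" if xy: "x \<in> set xs" "y \<in> set ys" for x y
  proof
    assume "gdist E x y = 0"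
    then show "x = y" using walk[OF xy] gdist_walk[where x = x and y = y and E = E] by fastforce
  next
    assume "x = y"
    then show "gdist E x y = 0" using gdist_le[where x = x and y = y and E = E and n = 0] by simp
  qed
  show "gdist E x z \<le> gdist E x y + gdist E y z"
    if q: "x \<in> set xs" "y \<in> set xs" "y \<in> set ys" "z \<in> set ys" for x y z
  proof -
    obtain i where i: "(x, y) \<in> ?r ^^ i" using walk[OF q(1,3)] by blast
    obtain j where j: "(y, z) \<in> ?r ^^ j" using walk[OF q(2,4)] by blast
    from gdist_walk[OF i] gdist_walk[OF j] have "(x, z) \<in> ?r ^^ (gdist E x y + gdist E y z)"
      unfolding relpow_add by (rule relcompI)
    then show ?thesis by (rule gdist_le)
  qed
  show "gdist E x y \<le> 3" if q: "x \<in> set xs" "y \<in> set ys" for x y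
  proof -
    obtain n where "n \<le> 3" "(x, y) \<in> ?r ^^ n" using walk[OF q] by blast
    then show ?thesis using gdist_le[where x = x and y = y and n = n and E = E] by simp
  qed
qed

section \<open>Time bound and size of the remainder\<close>

lemma Max_bigo_powr:
  fixes T :: "nat \<Rightarrow> nat"
  assumes T: "(\<lambda>n. real (T n)) \<in> O(\<lambda>n. real n powr p)" and p: "p \<ge> 2"
  shows "(\<lambda>n. real (100 * (n + 2)\<^sup>2 + Max (T ` {..n + 1}) + 20)) \<in> O(\<lambda>n. real n powr p)"
proof -
  obtain c where c: "c > 0" "eventually (\<lambda>n. norm (real (T n)) \<le> c * norm (real n powr p)) at_top"
    using T by (rule landau_o.bigE)
  then obtain N where N: "\<And>n. n \<ge> N \<Longrightarrow> real (T n) \<le> c * real n powr p"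
    by (auto simp: eventually_at_top_linorder)
  \<comment> \<open>The finitely many sizes below the asymptotic threshold are absorbed by an
    additive constant. The remaining bound is monotone in n, so it passes to the maximum over an
    initial segment.\<close>
  define C where "C = real (Max (T ` {..N}))"
  have T_le: "real (T n) \<le> c * real n powr p + C" for n
  proof (cases "n \<ge> N")
    case False
    then have "T n \<le> Max (T ` {..N})" by (intro Max_ge) auto
    then have "real (T n) \<le> C" by (simp add: C_def)
    moreover have "0 \<le> c * real n powr p" using c(1) by simp
    ultimately show ?thesis by simp
  qed (use N in \<open>auto simp: C_def intro: add_increasing2\<close>)
  have "real (100 * (n + 2)\<^sup>2 + Max (T ` {..n + 1}) + 20) \<le>
      (920 + c * 2 powr p + C) * real n powr p" if n: "n \<ge> 1" for n
  proof -
    have pow1: "1 \<le> real n powr p" using n p by (intro ge_one_powr_ge_zero) auto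
    have "real n powr 2 \<le> real n powr p" using n p by (intro powr_mono) auto
    then have pow2: "(real n)\<^sup>2 \<le> real n powr p" using n by (simp add: powr_numeral)
    have "real ((n + 2)\<^sup>2) \<le> (3 * real n)\<^sup>2"
      unfolding of_nat_power using n by (intro power_mono) auto
    then have 1: "real (100 * (n + 2)\<^sup>2) \<le> 900 * real n powr p"
      using pow2 by (simp add: power_mult_distrib)
    have "Max (T ` {..n + 1}) \<in> T ` {..n + 1}" by (intro Max_in) auto
    then obtain i where "i \<in> {..n + 1}" and i: "Max (T ` {..n + 1}) = T i" by blast
    have "real i powr p \<le> (2 * real n) powr p" using \<open>i \<in> {..n + 1}\<close> n p by (intro powr_mono2) auto
    also have "\<dots> = 2 powr p * real n powr p" by (simp add: powr_mult)
    finally have "c * real i powr p \<le> c * (2 powr p * real n powr p)"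
      using c(1) by (intro mult_left_mono) auto
    moreover have "C * 1 \<le> C * real n powr p"
      using pow1 by (intro mult_left_mono) (auto simp: C_def)
    ultimately have 2: "real (Max (T ` {..n + 1})) \<le> c * (2 powr p * real n powr p) + C * real n powr p"
      unfolding i using T_le[of i] by linarith
    have "real (100 * (n + 2)\<^sup>2 + Max (T ` {..n + 1}) + 20) =
        real (100 * (n + 2)\<^sup>2) + real (Max (T ` {..n + 1})) + 20" by simp
    also have "\<dots> \<le> 900 * real n powr p + (c * (2 powr p * real n powr p) + C * real n powr p)
        + 20 * real n powr p"
      using 1 2 pow1 by linarith
    also have "\<dots> = (920 + c * 2 powr p + C) * real n powr p" by (simp add: algebra_simps)
    finally show ?thesis .
  qed
  then have "eventually (\<lambda>n. norm (real (100 * (n + 2)\<^sup>2 + Max (T ` {..n + 1}) + 20)) \<le>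
      (920 + c * 2 powr p + C) * norm (real n powr p)) at_top"
    unfolding eventually_at_top_linorder by (intro exI[of _ 1]) simp
  then show ?thesis by (rule bigoI)
qed

text \<open>The remainder is at most \<open>deg_u\<close>, and also at most
  \<open>deg_v - deg_u\<close>, because subtracting the divisor once does not change it. Each
  alternative of the hypothesis makes one of these bounds at most
  \<open>(\<delta> / 3) * deg_v\<close>.\<close>

lemma excess_le:
  fixes \<delta> :: real
  assumes "deg_u \<le> deg_v" "\<delta> > 0"
    and "real deg_u \<le> (\<delta> / 3) * real deg_v \<or> real deg_u \<ge> (1 - \<delta> / 3) * real deg_v"
  shows "2 * real (Suc deg_v mod Suc deg_u) / real (Suc deg_v) \<le> \<delta>"
proof -
  let ?r = "Suc deg_v mod Suc deg_u"
  have "?r \<le> deg_u" using mod_less_divisor[of "Suc deg_u" "Suc deg_v"] by linarith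
  moreover have "?r \<le> deg_v - deg_u"
  proof -
    have "?r = (deg_v - deg_u) mod Suc deg_u" using assms(1) by (simp add: le_mod_geq)
    then show ?thesis by simp
  qed
  ultimately have "real ?r \<le> real deg_u" "real ?r \<le> real deg_v - real deg_u"
    using assms(1) by linarith+
  moreover have "(1 - \<delta> / 3) * real deg_v = real deg_v - (\<delta> / 3) * real deg_v"
    by (simp add: algebra_simps)
  ultimately have "real ?r \<le> (\<delta> / 3) * real deg_v"
    using assms(3) by linarith
  then have "3 * real ?r \<le> \<delta> * real deg_v" by simp
  moreover have "\<delta> * real deg_v \<le> \<delta> * real (Suc deg_v)"
    using assms(2) by (intro mult_left_mono) auto
  ultimately have "2 * real ?r \<le> \<delta> * real (Suc deg_v)" by linarith
  then show ?thesis by (simp add: divide_le_eq)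
qed

lemma outputs_in_mono:
  assumes "outputs_in k c xs ys w t \<beta>" "t \<le> t'"
  shows "outputs_in k c xs ys w t' \<beta>"
proof -
  obtain R M s where "exec (int (length xs + length ys + 2) ^ k) c (bip_input xs ys w) s (R, M)"
    "s \<le> t" "R 1 \<noteq> 0" "\<beta> = of_int (R 0) / of_int (R 1)"
    using assms(1) unfolding outputs_in_def by auto
  then show ?thesis
    unfolding outputs_in_def using assms(2)
    by (intro exI[of _ R] exI[of _ M] exI[of _ s]) simp
qed

lemma outputs_constant:
  assumes "1 \<le> length xs"
  shows "outputs_in 1 (Const 0 3 ;; Const 1 1) xs ys w 2 3"
proof -
  let ?W = "int (length xs + length ys + 2) ^ 1"
  have W: "\<bar>3\<bar> \<le> ?W" "\<bar>1\<bar> \<le> ?W" using assms by auto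
  obtain R M where s: "bip_input xs ys w = (R, M)" by (cases "bip_input xs ys w")
  have "exec ?W (Const 0 3 ;; Const 1 1) (bip_input xs ys w) (1 + 1) (R(0 := 3, 1 := 1), M)"
    unfolding s by (rule exec.Seq[OF exec.Const[OF W(1)] exec.Const[OF W(2)]])
  then show ?thesis
    unfolding outputs_in_def
    by (intro exI[of _ "R(0 := 3, 1 := 1)"] exI[of _ M] exI[of _ "1 + 1"]) simp
qed

theorem theorem1:
  fixes \<alpha> \<epsilon> \<mu> :: real
  assumes "\<epsilon> \<ge> 0" and "\<mu> \<ge> 0"
    and "\<exists>(\<AA> :: com) (k :: nat) (T :: nat \<Rightarrow> nat).
      (\<lambda>n. real (T n)) \<in> O(\<lambda>n. real n powr (2 + \<mu>)) \<and>
      (\<forall>(A :: nat set) (B :: nat set) w xs ys.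
         mpmct_instance A B w \<and> enumerates xs A \<and> enumerates ys B \<longrightarrow>
         (\<exists>\<beta>. outputs_in k \<AA> xs ys w (T (card A)) \<beta> \<and>
              is_estimate \<alpha> \<epsilon> (mpmct_value A B w) \<beta>))"
  shows "\<exists>(\<AA>' :: com) (k :: nat) (T :: nat \<Rightarrow> nat).
      (\<lambda>n. real (T n)) \<in> O(\<lambda>n. real n powr (2 + \<mu>)) \<and>
      (\<forall>(V :: 'a set) E u v xs ys.
         simple_graph V E \<and> {u, v} \<in> E \<and> deg E u \<le> deg E v \<and>
         enumerates xs (closed_nbr E u) \<and> enumerates ys (closed_nbr E v) \<longrightarrow>
         (\<exists>\<beta>. outputs_in k \<AA>' xs ys (gdist E) (T (deg E v)) \<beta> \<and>
              (deg E u + 1 dvd deg E v + 1 \<longrightarrow> is_estimate \<alpha> \<epsilon> (edge_EMD E u v) \<beta>) \<and>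
              (\<forall>\<delta>>0.
                 real (deg E u) \<le> (\<delta> / 3) * real (deg E v) \<or>
                 real (deg E u) \<ge> (1 - \<delta> / 3) * real (deg E v) \<longrightarrow>
                 is_estimate \<alpha> (\<epsilon> + \<delta>) (edge_EMD E u v) \<beta>)))"
proof -
  obtain c m T where T: "(\<lambda>n. real (T n)) \<in> O(\<lambda>n. real n powr (2 + \<mu>))"
    and alg: "\<And>(A :: nat set) (B :: nat set) w xs ys.
       mpmct_instance A B w \<Longrightarrow> enumerates xs A \<Longrightarrow> enumerates ys B \<Longrightarrow>
       \<exists>\<beta>. outputs_in m c xs ys w (T (card A)) \<beta> \<and> is_estimate \<alpha> \<epsilon> (mpmct_value A B w) \<beta>"
    using assms(3) by blast
  have edge: "token_matching xs ys (gdist E)" "length xs = Suc (deg E u)" "length ys = Suc (deg E v)"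
    "edge_EMD E u v = EMD (set xs) (set ys) (gdist E) (\<lambda>_. 1 / real (length xs)) (\<lambda>_. 1 / real (length ys))"
    if "simple_graph V E \<and> {u, v} \<in> E \<and> deg E u \<le> deg E v \<and>
         enumerates xs (closed_nbr E u) \<and> enumerates ys (closed_nbr E v)"
    for V :: "'a set" and E u v xs ys
  proof -
    show "token_matching xs ys (gdist E)" using that by (elim conjE) (rule token_matching_edge)
    show len: "length xs = Suc (deg E u)" "length ys = Suc (deg E v)"
      by (rule length_closed_nbr; use that in blast)+
    show "edge_EMD E u v = EMD (set xs) (set ys) (gdist E) (\<lambda>_. 1 / real (length xs)) (\<lambda>_. 1 / real (length ys))"
      using that unfolding edge_EMD_def len by (simp add: enumerates_def)
  qed
  show ?thesis
  proof (cases "\<alpha> \<ge> 0")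
    case True
    obtain N0 where N0: "uses_below N0 c" using uses_below_exists by blast
    \<comment> \<open>Adding 2 puts registers 0 and 1, which carry input and output, below
      \<open>N\<close> even if \<open>c\<close> never mentions them.\<close>
    define N where "N = N0 + 2"
    have N: "2 \<le> N" "uses_below N c" using uses_below_mono[OF N0] by (auto simp: N_def)
    show ?thesis
    proof (rule exI[of _ "emd_program N c"], rule exI[of _ "2 * m + 4"],
        rule exI[of _ "\<lambda>n. 100 * (n + 2)\<^sup>2 + Max (T ` {..n + 1}) + 20"],
        intro conjI allI impI)
      show "(\<lambda>n. real (100 * (n + 2)\<^sup>2 + Max (T ` {..n + 1}) + 20)) \<in> O(\<lambda>n. real n powr (2 + \<mu>))"
        by (rule Max_bigo_powr[OF T]) (use assms(2) in simp)
    next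
      fix V :: "'a set" and E u v xs ys
      assume h: "simple_graph V E \<and> {u, v} \<in> E \<and> deg E u \<le> deg E v \<and>
         enumerates xs (closed_nbr E u) \<and> enumerates ys (closed_nbr E v)"
      interpret token_matching xs ys "gdist E" by (rule edge(1)[OF h])
      note len = edge(2,3)[OF h] and emd_eq = edge(4)[OF h]
      obtain \<beta> where \<beta>: "outputs_in (2 * m + 4) (emd_program N c) xs ys (gdist E)
          (100 * (length ys + 1)\<^sup>2 + Max (T ` {..length ys}) + 20) \<beta>"
        "edge_EMD E u v \<le> \<beta>"
        "\<beta> \<le> \<alpha> * edge_EMD E u v + \<epsilon> + 2 * real r / real (length ys)"
        using emd_program_estimates[OF alg N True assms(1)] unfolding emd_eq by blast
      have r: "r = Suc (deg E v) mod Suc (deg E u)" by (simp add: r_def len)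
      show "\<exists>\<beta>. outputs_in (2 * m + 4) (emd_program N c) xs ys (gdist E)
            (100 * (deg E v + 2)\<^sup>2 + Max (T ` {..deg E v + 1}) + 20) \<beta> \<and>
          (deg E u + 1 dvd deg E v + 1 \<longrightarrow> is_estimate \<alpha> \<epsilon> (edge_EMD E u v) \<beta>) \<and>
          (\<forall>\<delta>>0. real (deg E u) \<le> (\<delta> / 3) * real (deg E v) \<or>
             real (deg E u) \<ge> (1 - \<delta> / 3) * real (deg E v) \<longrightarrow>
             is_estimate \<alpha> (\<epsilon> + \<delta>) (edge_EMD E u v) \<beta>)"
      proof (intro exI[of _ \<beta>] conjI allI impI)
        show "outputs_in (2 * m + 4) (emd_program N c) xs ys (gdist E)
            (100 * (deg E v + 2)\<^sup>2 + Max (T ` {..deg E v + 1}) + 20) \<beta>"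
          using \<beta>(1) by (simp add: len)
        assume "deg E u + 1 dvd deg E v + 1"
        then have "r = 0" unfolding r by simp
        then show "is_estimate \<alpha> \<epsilon> (edge_EMD E u v) \<beta>" using \<beta>(2,3) by (simp add: is_estimate_def)
      next
        fix \<delta> :: real
        assume "\<delta> > 0" "real (deg E u) \<le> (\<delta> / 3) * real (deg E v) \<or>
          real (deg E u) \<ge> (1 - \<delta> / 3) * real (deg E v)"
        then have "2 * real r / real (length ys) \<le> \<delta>"
          unfolding r len using h by (intro excess_le) auto
        then show "is_estimate \<alpha> (\<epsilon> + \<delta>) (edge_EMD E u v) \<beta>"
          using \<beta>(2,3) by (simp add: is_estimate_def)
      qed
    qed
  next
    case False
    text \<open>A negative \<open>\<alpha>\<close> reverses the monotonicity used above. But then the instance of value 3 forces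
      \<open>3 \<le> 3 \<alpha> + \<epsilon>\<close>, and the constant 3 is a good estimate of everything in \<open>[0, 3]\<close>.\<close>
    have "mpmct_instance {0::nat} {0::nat} (\<lambda>_ _. 3)" by (simp add: mpmct_instance_def)
    moreover have "enumerates [0::nat] {0}" by (simp add: enumerates_def)
    ultimately obtain \<beta> where "is_estimate \<alpha> \<epsilon> (mpmct_value {0::nat} {0::nat} (\<lambda>_ _. 3)) \<beta>"
      using alg by blast
    moreover have "mpmct_value {0::nat} {0::nat} (\<lambda>_ _. 3) = 3"
      using mpmct_value_witness[of "{0::nat}" "{0::nat}" "\<lambda>_ _. 3"] by auto
    ultimately have three: "3 \<le> 3 * \<alpha> + \<epsilon>" by (simp add: is_estimate_def)
    show ?thesis
    proof (rule exI[of _ "Const 0 3 ;; Const 1 1"], rule exI[of _ "1"],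
        rule exI[of _ "\<lambda>n. 100 * (n + 2)\<^sup>2 + Max (T ` {..n + 1}) + 20"],
        intro conjI allI impI)
      show "(\<lambda>n. real (100 * (n + 2)\<^sup>2 + Max (T ` {..n + 1}) + 20)) \<in> O(\<lambda>n. real n powr (2 + \<mu>))"
        by (rule Max_bigo_powr[OF T]) (use assms(2) in simp)
    next
      fix V :: "'a set" and E u v xs ys
      assume h: "simple_graph V E \<and> {u, v} \<in> E \<and> deg E u \<le> deg E v \<and>
         enumerates xs (closed_nbr E u) \<and> enumerates ys (closed_nbr E v)"
      interpret token_matching xs ys "gdist E" by (rule edge(1)[OF h])
      note len = edge(2,3)[OF h] and emd_eq = edge(4)[OF h]
      have bounds: "0 \<le> edge_EMD E u v" "edge_EMD E u v \<le> 3"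
        unfolding emd_eq by (rule emd_nonneg, rule emd_le_3)
      have "\<alpha> * 3 \<le> \<alpha> * edge_EMD E u v"
        using False bounds(2) by (intro mult_left_mono_neg) auto
      then have est: "is_estimate \<alpha> \<epsilon> (edge_EMD E u v) 3"
        using three bounds(2) by (simp add: is_estimate_def)
      have "outputs_in 1 (Const 0 3 ;; Const 1 1) xs ys (gdist E) 2 3"
        by (rule outputs_constant) (simp add: len)
      then have out: "outputs_in 1 (Const 0 3 ;; Const 1 1) xs ys (gdist E)
          (100 * (deg E v + 2)\<^sup>2 + Max (T ` {..deg E v + 1}) + 20) 3"
        by (rule outputs_in_mono) simp
      show "\<exists>\<beta>. outputs_in 1 (Const 0 3 ;; Const 1 1) xs ys (gdist E)
            (100 * (deg E v + 2)\<^sup>2 + Max (T ` {..deg E v + 1}) + 20) \<beta> \<and>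
          (deg E u + 1 dvd deg E v + 1 \<longrightarrow> is_estimate \<alpha> \<epsilon> (edge_EMD E u v) \<beta>) \<and>
          (\<forall>\<delta>>0. real (deg E u) \<le> (\<delta> / 3) * real (deg E v) \<or>
             real (deg E u) \<ge> (1 - \<delta> / 3) * real (deg E v) \<longrightarrow>
             is_estimate \<alpha> (\<epsilon> + \<delta>) (edge_EMD E u v) \<beta>)"
        using out est by (intro exI[of _ 3]) (auto simp: is_estimate_def)
    qed
  qed
qed

end
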